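(* Let $m\in\mathbb N$, and for $a>0$ let $\mathcal A_m^a(\omega)$ be the random $\tilde{\mathcal D}_m$-attractor of the random dynamical system $\Xi_m^a$ on $X_m=\mathbb C^{2m+1}$ generated by $$\frac{dU}{dt}=(\lambda+i\mu)\Lambda_mU-(\gamma+i\beta)U-(k+i\nu)e^{paz(\theta_t\omega)}|U|^pU+e^{-az(\theta_t\omega)}g^m+az(\theta_t\omega)U.$$ The truncated random attractor is upper semi-continuous in $a$: for every $a_0>0$, every sequence $a_n>0$ with $a_n\to a_0$, and every $\omega\in\Omega$, $$\lim_{n\to\infty}\mathrm{dist}_{X_m}\big(\mathcal A_m^{a_n}(\omega),\mathcal A_m^{a_0}(\omega)\big)=0.$$
   Context: Parameters: $\lambda,\gamma,k,p>0$, $\mu,\beta,\nu\in\mathbb R$, $\gamma>4\lambda$; $g=(g_j)_{j\in\mathbb Z}$ is a fixed complex sequence with $\sum_j|g_j|^{(p+2)/(p+1)}<\infty$ (hence $g\in\ell^2$). $X_m=\mathbb C^{2m+1}$, elements $z=(z_j)_{|j|\le m}$, Euclidean norm $\|\cdot\|$; $|z|^pz=(|z_j|^pz_j)_{|j|\le m}$; $g^m=(g_j)_{|j|\le m}$; $(\Lambda_mz)_j=-z_{j-1}+2z_j-z_{j+1}$ for $|j|\le m$ with $z_{-m-1}=z_m$, $z_{m+1}=z_{-m}$. $\mathrm{dist}_{X_m}(A,B)=\sup_{a\in A}\inf_{b\in B}\|a-b\|$. Probability space: $\Omega=\{\omega\in C(\mathbb R,\mathbb R):\omega(0)=0\}$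 with the Borel $\sigma$-algebra $\mathcal F$ of the compact-open topology, two-sided Wiener measure $\mathbb P$, and shifts $\theta_t\omega(\cdot)=\omega(t+\cdot)-\omega(t)$. The Ornstein–Uhlenbeck process is $z(\theta_t\omega)=-\int_{-\infty}^0e^s(\theta_t\omega)(s)\,ds$; $\Omega$ is restricted to a $\theta$-invariant set of full measure on which $t\mapsto z(\theta_t\omega)$ is continuous, $\lim_{t\to\pm\infty}|z(\theta_t\omega)|/|t|=0$ and $\lim_{t\to\pm\infty}\frac1t\int_0^tz(\theta_s\omega)\,ds=0$. $\Xi^a_m(t,\omega)U_0$ is the value at time $t\ge0$ of the solution of the random equation with $U(0)=U_0\in X_m$. $\tilde{\mathcal D}_m$ is the universe of closed random sets $\mathcal D=\{\mathcal D(\omega)\}$ in $X_m$ with $\lim_{t\to+\infty}e^{-\rho t}\sup_{\phi\in\mathcal D(\theta_{-t}\omega)}\|\phi\|=0$ for all $\rho>0$, $\omega\in\Omega$. The random $\tilde{\mathcal D}_m$-attractor is the random compact set $\{\mathcal A_m^a(\omega)\}\in\tilde{\mathcal D}_m$ with $\Xi_m^a(t,\omega)\mathcal A_m^a(\omega)=\mathcal A_m^a(\theta_t\omega)$ for all $t\ge0$, $\omega\in\Omega$, and $\lim_{t\to\infty}\mathrm{dist}_{X_m}(\Xi_m^a(t,\theta_{-t}\omega)\mathcal D(\theta_{-t}\omega),\mathcal A_m^a(\omega))=0$ for all $\mathcal D\in\tilde{\mathcal D}_m$, $\omega\in\Omega$. *)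

theory Defs
  imports "HOL-Probability.Probability"
begin

section \<open>The phase space \<open>X\<^sub>m\<close>\<close>

text \<open>Vectors indexed by \<open>-m, \<dots>, m\<close> are functions on \<^typ>\<open>int\<close> that vanish
  outside this range, so that \<open>X m\<close> is a copy of \<open>\<complex>\<close> to the power \<open>2m+1\<close>.\<close>

definition X :: "nat \<Rightarrow> (int \<Rightarrow> complex) set" where
  "X m = {z. \<forall>j. \<bar>j\<bar> > int m \<longrightarrow> z j = 0}"

definition norm_X :: "nat \<Rightarrow> (int \<Rightarrow> complex) \<Rightarrow> real" where
  "norm_X m z = L2_set (\<lambda>j. cmod (z j)) {- int m..int m}"

definition d_X :: "nat \<Rightarrow> (int \<Rightarrow> complex) \<Rightarrow> (int \<Rightarrow> complex) \<Rightarrow> real" where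
  "d_X m x y = norm_X m (\<lambda>j. x j - y j)"

lemma Metric_space_X: "Metric_space (X m) (d_X m)"
proof
  fix x y z :: "int \<Rightarrow> complex"
  show "0 \<le> d_X m x y"
    by (simp add: d_X_def norm_X_def)
  show "d_X m x y = d_X m y x"
    by (simp add: d_X_def norm_X_def norm_minus_commute)
  show "d_X m x y = 0 \<longleftrightarrow> x = y" if "x \<in> X m" "y \<in> X m"
  proof -
    have "d_X m x y = 0 \<longleftrightarrow> (\<forall>j\<in>{- int m..int m}. x j = y j)"
      by (simp add: d_X_def norm_X_def L2_set_eq_0_iff)
    also have "\<dots> \<longleftrightarrow> x = y"
    proof
      assume eq: "\<forall>j\<in>{- int m..int m}. x j = y j"
      show "x = y"
      proof
        fix j show "x j = y j"
          using eq that by (cases "\<bar>j\<bar> > int m") (auto simp: X_def abs_le_iff not_less)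
      qed
    qed auto
    finally show ?thesis .
  qed
  show "d_X m x z \<le> d_X m x y + d_X m y z"
  proof -
    have "d_X m x z \<le> L2_set (\<lambda>j. cmod (x j - y j) + cmod (y j - z j)) {- int m..int m}"
      unfolding d_X_def norm_X_def
      by (intro L2_set_mono) (auto simp: dist_norm[symmetric] intro: dist_triangle)
    also have "\<dots> \<le> d_X m x y + d_X m y z"
      unfolding d_X_def norm_X_def by (rule L2_set_triangle_ineq)
    finally show ?thesis .
  qed
qed

abbreviation top_X :: "nat \<Rightarrow> (int \<Rightarrow> complex) topology" where
  "top_X m \<equiv> Metric_space.mtopology (X m) (d_X m)"

text \<open>Suprema and infima are taken in \<^typ>\<open>ennreal\<close>, where those of unbounded or empty
  sets have their usual values.\<close>

definition point_dist_X :: "nat \<Rightarrow> (int \<Rightarrow> complex) \<Rightarrow> (int \<Rightarrow> complex) set \<Rightarrow> ennreal" where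
  "point_dist_X m x B = (INF b\<in>B. ennreal (d_X m x b))"

definition dist_X :: "nat \<Rightarrow> (int \<Rightarrow> complex) set \<Rightarrow> (int \<Rightarrow> complex) set \<Rightarrow> ennreal" where
  "dist_X m A B = (SUP a\<in>A. point_dist_X m a B)"

section \<open>Two-sided Wiener space and the Ornstein--Uhlenbeck process\<close>

definition path_space :: "(real \<Rightarrow> real) set" where
  "path_space = {\<omega>. continuous_on UNIV \<omega> \<and> \<omega> 0 = 0}"

definition compact_open_topology :: "(real \<Rightarrow> real) topology" where
  "compact_open_topology = topology_generated_by
     {{\<omega> \<in> path_space. \<omega> ` K \<subseteq> V} | K V. compact K \<and> open V}"

definition path_borel :: "(real \<Rightarrow> real) measure" where
  "path_borel = sigma path_space {U. openin compact_open_topology U}"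

definition shift :: "real \<Rightarrow> (real \<Rightarrow> real) \<Rightarrow> real \<Rightarrow> real" where
  "shift t \<omega> = (\<lambda>s. \<omega> (t + s) - \<omega> t)"

text \<open>The second parameter of \<^const>\<open>normal_density\<close> is the standard deviation.\<close>

definition two_sided_Wiener :: "(real \<Rightarrow> real) measure \<Rightarrow> bool" where
  "two_sided_Wiener P \<longleftrightarrow>
     prob_space P \<and> space P = path_space \<and> sets P = sets path_borel \<and>
     (\<forall>s t. s < t \<longrightarrow>
        distributed P lborel (\<lambda>\<omega>. \<omega> t - \<omega> s) (\<lambda>x. ennreal (normal_density 0 (sqrt (t - s)) x))) \<and>
     (\<forall>n (\<tau> :: nat \<Rightarrow> real). strict_mono_on {..n} \<tau> \<longrightarrow>
        prob_space.indep_vars P (\<lambda>_. borel) (\<lambda>i \<omega>. \<omega> (\<tau> (Suc i)) - \<omega> (\<tau> i)) {..<n})"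

text \<open>The random variable \<open>z(\<omega>)\<close>; the process is \<open>t \<mapsto> OU (shift t \<omega>)\<close>. The integral converges
  absolutely almost surely; where it does not, its value is \<open>0\<close> by convention.\<close>

definition OU :: "(real \<Rightarrow> real) \<Rightarrow> real" where
  "OU \<omega> = - (LINT s:{..0}|lborel. exp s * \<omega> s)"

text \<open>The sets of paths to which the path space may be restricted.\<close>

definition admissible_paths :: "(real \<Rightarrow> real) measure \<Rightarrow> (real \<Rightarrow> real) set \<Rightarrow> bool" where
  "admissible_paths P \<Omega> \<longleftrightarrow>
     \<Omega> \<in> sets P \<and> measure P \<Omega> = 1 \<and> (\<forall>t. shift t ` \<Omega> = \<Omega>) \<and>
     (\<forall>\<omega>\<in>\<Omega>.
        continuous_on UNIV (\<lambda>t. OU (shift t \<omega>)) \<and>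
        ((\<lambda>t. \<bar>OU (shift t \<omega>)\<bar> / \<bar>t\<bar>) \<longlongrightarrow> 0) at_top \<and>
        ((\<lambda>t. \<bar>OU (shift t \<omega>)\<bar> / \<bar>t\<bar>) \<longlongrightarrow> 0) at_bot \<and>
        ((\<lambda>t. (1 / t) * (LBINT s=0..t. OU (shift s \<omega>))) \<longlongrightarrow> 0) at_top \<and>
        ((\<lambda>t. (1 / t) * (LBINT s=0..t. OU (shift s \<omega>))) \<longlongrightarrow> 0) at_bot)"

section \<open>The truncated random equation\<close>

text \<open>Discrete Laplacian with periodic boundary conditions \<open>z\<^sub>-\<^sub>m\<^sub>-\<^sub>1 = z\<^sub>m\<close>,
  \<open>z\<^sub>m\<^sub>+\<^sub>1 = z\<^sub>-\<^sub>m\<close>; only its values at \<open>\<bar>j\<bar> \<le> m\<close> matter.\<close>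

definition Lap :: "nat \<Rightarrow> (int \<Rightarrow> complex) \<Rightarrow> int \<Rightarrow> complex" where
  "Lap m z j =
     - (if j = - int m then z (int m) else z (j - 1)) + 2 * z j
     - (if j = int m then z (- int m) else z (j + 1))"

definition rhs ::
  "real \<Rightarrow> real \<Rightarrow> real \<Rightarrow> real \<Rightarrow> real \<Rightarrow> real \<Rightarrow> real \<Rightarrow> (int \<Rightarrow> complex) \<Rightarrow> nat \<Rightarrow> real \<Rightarrow>
   (real \<Rightarrow> real) \<Rightarrow> real \<Rightarrow> (int \<Rightarrow> complex) \<Rightarrow> int \<Rightarrow> complex" where
  "rhs lam \<mu> \<gamma> \<beta> k \<nu> p g m a \<omega> t u j =
     Complex lam \<mu> * Lap m u j
     - Complex \<gamma> \<beta> * u j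
     - Complex k \<nu> * complex_of_real (exp (p * a * OU (shift t \<omega>)))
         * (complex_of_real (cmod (u j) powr p) * u j)
     + complex_of_real (exp (- a * OU (shift t \<omega>))) * g j
     + complex_of_real (a * OU (shift t \<omega>)) * u j"

definition solves ::
  "nat \<Rightarrow> (real \<Rightarrow> (int \<Rightarrow> complex) \<Rightarrow> int \<Rightarrow> complex) \<Rightarrow> (int \<Rightarrow> complex) \<Rightarrow>
   (real \<Rightarrow> int \<Rightarrow> complex) \<Rightarrow> bool" where
  "solves m F U0 U \<longleftrightarrow> U 0 = U0 \<and>
     (\<forall>t\<ge>0. U t \<in> X m \<and>
        (\<forall>j\<in>{- int m..int m}. ((\<lambda>s. U s j) has_vector_derivative F t (U t) j) (at t within {0..})))"

definition Xi ::
  "real \<Rightarrow> real \<Rightarrow> real \<Rightarrow> real \<Rightarrow> real \<Rightarrow> real \<Rightarrow> real \<Rightarrow> (int \<Rightarrow> complex) \<Rightarrow> nat \<Rightarrow> real \<Rightarrow>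
   real \<Rightarrow> (real \<Rightarrow> real) \<Rightarrow> (int \<Rightarrow> complex) \<Rightarrow> int \<Rightarrow> complex" where
  "Xi lam \<mu> \<gamma> \<beta> k \<nu> p g m a t \<omega> U0 =
     (THE x. \<exists>U. solves m (rhs lam \<mu> \<gamma> \<beta> k \<nu> p g m a \<omega>) U0 U \<and> x = U t)"

section \<open>Random sets and random attractors\<close>

text \<open>Random sets have nonempty values and measurable distance functions.\<close>

definition closed_random_set ::
  "nat \<Rightarrow> (real \<Rightarrow> real) measure \<Rightarrow> (real \<Rightarrow> real) set \<Rightarrow> ((real \<Rightarrow> real) \<Rightarrow> (int \<Rightarrow> complex) set) \<Rightarrow> bool"
  where
  "closed_random_set m P \<Omega> D \<longleftrightarrow>
     (\<forall>\<omega>\<in>\<Omega>. D \<omega> \<noteq> {} \<and> closedin (top_X m) (D \<omega>)) \<and>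
     (\<forall>x\<in>X m. (\<lambda>\<omega>. point_dist_X m x (D \<omega>)) \<in> borel_measurable (restrict_space P \<Omega>))"

definition tempered_universe ::
  "nat \<Rightarrow> (real \<Rightarrow> real) measure \<Rightarrow> (real \<Rightarrow> real) set \<Rightarrow> ((real \<Rightarrow> real) \<Rightarrow> (int \<Rightarrow> complex) set) set"
  where
  "tempered_universe m P \<Omega> = {D. closed_random_set m P \<Omega> D \<and>
     (\<forall>\<rho>>0. \<forall>\<omega>\<in>\<Omega>.
        ((\<lambda>t. ennreal (exp (- \<rho> * t)) * (SUP \<phi>\<in>D (shift (- t) \<omega>). ennreal (norm_X m \<phi>))) \<longlongrightarrow> 0)
          at_top)}"

definition random_attractor ::
  "nat \<Rightarrow> (real \<Rightarrow> real) measure \<Rightarrow> (real \<Rightarrow> real) set \<Rightarrow>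
   (real \<Rightarrow> (real \<Rightarrow> real) \<Rightarrow> (int \<Rightarrow> complex) \<Rightarrow> int \<Rightarrow> complex) \<Rightarrow>
   ((real \<Rightarrow> real) \<Rightarrow> (int \<Rightarrow> complex) set) \<Rightarrow> bool"
  where
  "random_attractor m P \<Omega> \<Phi> A \<longleftrightarrow>
     A \<in> tempered_universe m P \<Omega> \<and>
     (\<forall>\<omega>\<in>\<Omega>. compactin (top_X m) (A \<omega>)) \<and>
     (\<forall>\<omega>\<in>\<Omega>. \<forall>t\<ge>0. \<Phi> t \<omega> ` A \<omega> = A (shift t \<omega>)) \<and>
     (\<forall>D\<in>tempered_universe m P \<Omega>. \<forall>\<omega>\<in>\<Omega>.
        ((\<lambda>t. dist_X m (\<Phi> t (shift (- t) \<omega>) ` D (shift (- t) \<omega>)) (A \<omega>)) \<longlongrightarrow> 0) at_top)"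

end

theory Submission
  imports Defs
begin

text \<open>
  Fix \<open>\<omega>\<close> and write \<open>A\<^sub>a\<close> for the attractor with parameter \<open>a\<close>. Upper semicontinuity rests on two
  properties of the random equation: a bound on the attractors that is uniform for \<open>a\<close> in bounded sets,
  and continuous dependence of the solutions on \<open>a\<close> over finite times.

  The uniform bound comes from the superlinear damping \<open>- k exp (p a z) \<bar>U\<bar>\<^sup>p U\<close>. Together with the
  positivity of \<open>\<gamma> - 4 \<lambda>\<close>, which absorbs the discrete Laplacian, it makes a solution forget the size of
  its initial value within one unit of time: \<open>\<parallel>U(1)\<parallel>\<^sup>2 \<le> K exp (4 M Y)\<close>, where \<open>M\<close> bounds the
  parameter and \<open>Y\<close> bounds the Ornstein--Uhlenbeck path on the unit interval (lemma
  \<open>absorbed_in_unit_time\<close>). By invariance every point of \<open>A\<^sub>a(\<theta>\<^sub>-\<^sub>\<tau> \<omega>)\<close> is the value at time 1 of a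
  solution that started at noise \<open>\<theta>\<^sub>-\<^sub>\<tau>\<^sub>-\<^sub>1 \<omega>\<close>, so it obeys this bound, and since the path
  grows sublinearly, \<open>Y\<close> is at most \<open>C + \<eta> (\<tau> + 1)\<close> with \<open>\<eta>\<close> as small as desired
  (\<open>attractors_uniformly_tempered\<close>).

  Consequently \<open>D(\<omega>)\<close>, the closure of the union of all \<open>A\<^sub>a\<^sub>n(\<omega>)\<close>, belongs to the tempered universe
  (\<open>closed_union_of_attractors_tempered\<close>). Its measurability is inherited from the attractors, because
  the distance to a countable union is a countable infimum of distances. Hence \<open>A\<^sub>a\<^sub>0\<close> attracts
  \<open>D\<close>: for some \<open>T\<close> the image of \<open>D(\<theta>\<^sub>-\<^sub>T \<omega>)\<close> under the flow with parameter \<open>a\<^sub>0\<close> lies within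
  \<open>\<epsilon>\<close> of \<open>A\<^sub>a\<^sub>0(\<omega>)\<close>. On \<open>[0, T]\<close> and for initial values in the bounded set \<open>D(\<theta>\<^sub>-\<^sub>T \<omega>)\<close>, solutions are
  Lipschitz in the parameter (\<open>solution_stability\<close>), so for large \<open>n\<close> the set \<open>A\<^sub>a\<^sub>n(\<omega>)\<close>, which is
  the image of \<open>A\<^sub>a\<^sub>n(\<theta>\<^sub>-\<^sub>T \<omega>)\<close>, lies within \<open>\<epsilon>\<close> of that image and within \<open>2 \<epsilon>\<close> of \<open>A\<^sub>a\<^sub>0(\<omega>)\<close>.

  The flow is given as the unique value of a solution, so all of this presupposes global existence and
  uniqueness. Existence is shown by Picard iteration for the equation in which \<open>\<bar>U\<bar>\<^sup>p\<close> is cut off at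
  the level of an a priori energy bound; the cut equation is globally Lipschitz, satisfies the same
  energy bound, and therefore its solution never exceeds the cut-off level.
\<close>

section \<open>Differential inequalities\<close>

text \<open>The function \<open>exp (- E) * \<phi> - B\<close> is nonincreasing: multiplying by the integrating factor \<open>exp (- E)\<close>
  cancels the linear term. The forcing enters only through a function \<open>B\<close> that grows at least as fast
  as \<open>exp (- E) * \<beta>\<close>, so that explicit \<open>B\<close> can be used and no integral has to be computed.\<close>

lemma gronwall_integrating_factor:
  fixes \<phi> \<phi>' E \<alpha> \<beta> B B' :: "real \<Rightarrow> real"
  assumes "s \<le> t"
    and \<phi>: "\<And>x. x \<in> {s..t} \<Longrightarrow> (\<phi> has_real_derivative \<phi>' x) (at x within {s..t})"
    and E: "\<And>x. x \<in> {s..t} \<Longrightarrow> (E has_real_derivative \<alpha> x) (at x within {s..t})"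
    and B: "\<And>x. x \<in> {s..t} \<Longrightarrow> (B has_real_derivative B' x) (at x within {s..t})"
    and ineq: "\<And>x. x \<in> {s..t} \<Longrightarrow> \<phi>' x \<le> \<alpha> x * \<phi> x + \<beta> x"
    and forcing: "\<And>x. x \<in> {s..t} \<Longrightarrow> exp (- E x) * \<beta> x \<le> B' x"
  shows "exp (- E t) * \<phi> t - B t \<le> exp (- E s) * \<phi> s - B s"
proof (cases "s = t")
  case False
  then have "s < t" using assms(1) by simp
  define \<psi> where "\<psi> = (\<lambda>x. exp (- E x) * \<phi> x - B x)"
  define \<psi>' where "\<psi>' = (\<lambda>x. exp (- E x) * (\<phi>' x - \<alpha> x * \<phi> x) - B' x)"
  have der: "(\<psi> has_real_derivative \<psi>' x) (at x within {s..t})" if "x \<in> {s..t}" for x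
    unfolding \<psi>_def \<psi>'_def using \<phi>[OF that] E[OF that] B[OF that]
    by (auto intro!: derivative_eq_intros simp: algebra_simps)
  have nonpos: "\<psi>' x \<le> 0" if "x \<in> {s..t}" for x
  proof -
    have "exp (- E x) * (\<phi>' x - \<alpha> x * \<phi> x) \<le> exp (- E x) * \<beta> x"
      using ineq[OF that] by (intro mult_left_mono) auto
    also note forcing[OF that]
    finally have "exp (- E x) * (\<phi>' x - \<alpha> x * \<phi> x) \<le> B' x" .
    then show ?thesis by (simp only: \<psi>'_def diff_le_0_iff_le)
  qed
  obtain x where "x \<in> {s<..<t}" "\<psi> t - \<psi> s = \<psi>' x * (t - s)"
    using mvt_simple[OF \<open>s < t\<close>, of \<psi> "\<lambda>x h. \<psi>' x * h"] der
    by (auto simp: has_field_derivative_def)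
  then have "\<psi> t - \<psi> s \<le> 0"
    using nonpos[of x] \<open>s < t\<close> by (simp add: mult_nonpos_nonneg)
  then show ?thesis by (simp add: \<psi>_def)
qed simp

text \<open>The left-hand side is nonpositive once \<open>x\<close> exceeds \<open>(A / c) powr (1 / q)\<close>; below this threshold the
  linear term alone is at most the right-hand side.\<close>

lemma superlinear_absorption_bound:
  fixes A c q x :: real
  assumes "A > 0" "c > 0" "q > 0" "x \<ge> 0"
  shows "A * x - c * x powr (1 + q) \<le> A powr (1 + 1 / q) / c powr (1 / q)"
proof (cases "A \<le> c * x powr q")
  case True
  then have "x * A \<le> x * (c * x powr q)" using assms by (intro mult_left_mono) auto
  moreover have "x * (c * x powr q) = c * x powr (1 + q)"
    using assms by (cases "x = 0") (auto simp: powr_add)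
  ultimately have "A * x - c * x powr (1 + q) \<le> 0" by (simp add: mult.commute)
  also have "0 \<le> A powr (1 + 1 / q) / c powr (1 / q)" by simp
  finally show ?thesis .
next
  case False
  then have "x powr q \<le> A / c" using assms by (simp add: field_simps)
  then have "(x powr q) powr (1 / q) \<le> (A / c) powr (1 / q)" using assms by (intro powr_mono2) auto
  then have "x \<le> (A / c) powr (1 / q)" using assms by (simp add: powr_powr)
  then have "A * x \<le> A * (A / c) powr (1 / q)" using assms by (intro mult_left_mono) auto
  also have "\<dots> = A powr (1 + 1 / q) / c powr (1 / q)" using assms by (simp add: powr_divide powr_add)
  finally show ?thesis using assms by (smt (verit) mult_nonneg_nonneg powr_ge_zero)
qed

text \<open>A term \<open>- c \<phi> powr (1 + q)\<close> brings \<open>\<phi>\<close> down from arbitrarily large values in unit time. To see this without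
  solving the comparison equation, multiply \<open>\<phi>\<close> by the weight \<open>x powr s\<close> with \<open>s = 1 + 1 / q\<close>, which
  vanishes at 0 and so removes the initial value. Its derivative adds \<open>s / x\<close> to the linear coefficient,
  and the exponent \<open>s\<close> is exactly the one for which the singularity
  \<open>(1 / x) powr s\<close> left by the previous lemma is cancelled by the weight.\<close>

lemma superlinear_damping_forgets_initial_value:
  fixes \<phi> \<phi>' :: "real \<Rightarrow> real" and \<alpha> \<beta> c q :: real
  assumes pos: "c > 0" "q > 0" "\<alpha> \<ge> 0" "\<beta> \<ge> 0"
    and nonneg: "\<And>x. x \<in> {0..1} \<Longrightarrow> \<phi> x \<ge> 0"
    and der: "\<And>x. x \<in> {0..1} \<Longrightarrow> (\<phi> has_real_derivative \<phi>' x) (at x within {0..1})"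
    and ineq: "\<And>x. x \<in> {0..1} \<Longrightarrow> \<phi>' x \<le> \<alpha> * \<phi> x - c * \<phi> x powr (1 + q) + \<beta>"
  shows "\<phi> 1 \<le> (1 + 1 / q + \<alpha>) powr (1 + 1 / q) / c powr (1 / q) + \<beta>"
proof -
  define s where "s = 1 + 1 / q"
  have "s > 0" using pos by (simp add: s_def add_pos_pos)
  \<comment> \<open>The weighted function vanishes at 0, whatever \<open>\<phi> 0\<close> is.\<close>
  define f where "f = (\<lambda>x. x powr s * \<phi> x)"
  define f' where "f' = (\<lambda>x. s * x powr (s - 1) * \<phi> x + x powr s * \<phi>' x)"
  have fder: "(f has_real_derivative f' x) (at x)" if "0 < x" "x < 1" for x
  proof -
    have "(\<phi> has_real_derivative \<phi>' x) (at x)"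
      using der[of x] that at_within_Icc_at[of 0 x 1] by simp
    then show ?thesis unfolding f_def f'_def
      using that by (auto intro!: derivative_eq_intros simp: powr_diff field_simps)
  qed
  have "continuous_on {0..1} \<phi>" using der by (rule DERIV_continuous_on)
  then have fcont: "continuous_on {0..1} f"
    unfolding f_def using \<open>s > 0\<close> by (intro continuous_on_mult continuous_on_powr' continuous_on_id continuous_on_const) auto
  obtain l z where z: "0 < z" "z < 1" "(f has_real_derivative l) (at z)" "f 1 - f 0 = (1 - 0) * l"
    using MVT[of 0 1 f] fcont fder by (auto simp: real_differentiable_def)
  then have l: "l = f' z" using fder DERIV_unique by blast
  \<comment> \<open>An upper bound for the linear coefficient \<open>s / z + \<alpha>\<close>, valid because \<open>z \<le> 1\<close>.\<close>
  define A where "A = (s + \<alpha>) / z"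
  have "A > 0" using z \<open>s > 0\<close> pos by (simp add: A_def)
  have "f' z = z powr s * (s / z * \<phi> z + \<phi>' z)"
    using z by (simp add: f'_def powr_diff field_simps)
  also have "\<dots> \<le> z powr s * (A powr s / c powr (1 / q) + \<beta>)"
  proof (rule mult_left_mono)
    have "s / z + \<alpha> \<le> A" using z pos by (simp add: A_def add_divide_distrib pos_le_divide_eq mult_left_le)
    then have "(s / z + \<alpha>) * \<phi> z \<le> A * \<phi> z" using nonneg[of z] z by (intro mult_right_mono) auto
    moreover have "A * \<phi> z - c * \<phi> z powr (1 + q) \<le> A powr s / c powr (1 / q)"
      unfolding s_def using \<open>A > 0\<close> pos nonneg[of z] z by (intro superlinear_absorption_bound) auto
    ultimately show "s / z * \<phi> z + \<phi>' z \<le> A powr s / c powr (1 / q) + \<beta>"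
      using ineq[of z] z by (simp add: distrib_right)
  qed simp
  also have "\<dots> = (s + \<alpha>) powr s / c powr (1 / q) + z powr s * \<beta>"
    using z \<open>s > 0\<close> pos by (simp add: A_def powr_divide distrib_left)
  also have "z powr s * \<beta> \<le> 1 * \<beta>"
    using z \<open>s > 0\<close> pos by (intro mult_right_mono powr_le1) auto
  finally have "f' z \<le> (s + \<alpha>) powr s / c powr (1 / q) + \<beta>" by simp
  moreover have "f 1 - f 0 = \<phi> 1" using \<open>s > 0\<close> by (simp add: f_def)
  ultimately show ?thesis using z l by (simp add: s_def)
qed

lemma continuous_real_antiderivative:
  fixes f :: "real \<Rightarrow> real"
  assumes "continuous_on UNIV f"
  obtains F where "\<And>x. (F has_real_derivative f x) (at x)" "F 0 = 0"
proof -
  obtain F where F: "\<And>x. (F has_vector_derivative f x) (at x)"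
    using einterval_antiderivative[of "-\<infinity>" "\<infinity>" f] assms
    by (auto simp: continuous_on_eq_continuous_at)
  have "((\<lambda>x. F x - F 0) has_real_derivative f x) (at x)" for x
    using F[of x] by (auto intro!: derivative_eq_intros simp: has_real_derivative_iff_has_vector_derivative)
  then show ?thesis using that[of "\<lambda>x. F x - F 0"] by simp
qed

lemma bounded_on_compact_interval:
  fixes f :: "real \<Rightarrow> real"
  assumes "continuous_on {a..b} f"
  obtains C where "C \<ge> 0" "\<And>t. t \<in> {a..b} \<Longrightarrow> \<bar>f t\<bar> \<le> C"
proof -
  have "bounded (f ` {a..b})"
    using assms by (intro compact_imp_bounded compact_continuous_image) auto
  then obtain C where "\<forall>t\<in>{a..b}. \<bar>f t\<bar> \<le> C" by (auto simp: bounded_iff)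
  then show ?thesis using that[of "\<bar>C\<bar>"] by force
qed

lemma sublinear_bound_at_bot:
  fixes f :: "real \<Rightarrow> real"
  assumes "continuous_on UNIV f" "((\<lambda>t. \<bar>f t\<bar> / \<bar>t\<bar>) \<longlongrightarrow> 0) at_bot" "\<eta> > 0"
  obtains C where "C \<ge> 0" "\<And>r. r \<le> 0 \<Longrightarrow> \<bar>f r\<bar> \<le> C + \<eta> * \<bar>r\<bar>"
proof -
  have "\<forall>\<^sub>F t in at_bot. \<bar>f t\<bar> / \<bar>t\<bar> < \<eta>"
    by (rule order_tendstoD(2)[OF assms(2,3)])
  then obtain N where N: "\<And>t. t \<le> N \<Longrightarrow> \<bar>f t\<bar> / \<bar>t\<bar> < \<eta>"
    by (auto simp: eventually_at_bot_linorder)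
  \<comment> \<open>Staying below \<open>-1\<close> avoids the quotient at 0.\<close>
  define N' where "N' = min N (-1)"
  obtain C where C: "C \<ge> 0" "\<And>t. t \<in> {N'..0} \<Longrightarrow> \<bar>f t\<bar> \<le> C"
    using bounded_on_compact_interval[of N' 0 f] continuous_on_subset[OF assms(1), of "{N'..0}"] by auto
  have "\<bar>f r\<bar> \<le> C + \<eta> * \<bar>r\<bar>" if "r \<le> 0" for r
  proof (cases "r \<ge> N'")
    case True
    then have "\<bar>f r\<bar> \<le> C" using C(2)[of r] that by simp
    moreover have "0 \<le> \<eta> * \<bar>r\<bar>" using assms(3) by simp
    ultimately show ?thesis by linarith
  next
    case False
    then have "\<bar>f r\<bar> / \<bar>r\<bar> < \<eta>" "r < 0" using N[of r] by (auto simp: N'_def)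
    then have "\<bar>f r\<bar> < \<eta> * \<bar>r\<bar>" by (subst (asm) pos_divide_less_eq) auto
    then show ?thesis using C(1) by simp
  qed
  then show ?thesis using C(1) by (rule that[rotated])
qed

lemma abs_exp_diff_le:
  fixes x y c :: real
  assumes "x \<le> c" "y \<le> c"
  shows "\<bar>exp x - exp y\<bar> \<le> exp c * \<bar>x - y\<bar>"
proof -
  have *: "exp x - exp y \<le> exp c * \<bar>x - y\<bar>" if "x \<le> c" for x y :: real
  proof -
    have "exp x * (1 + (y - x)) \<le> exp x * exp (y - x)"
      by (intro mult_left_mono exp_ge_add_one_self) auto
    then have "exp x - exp y \<le> exp x * (x - y)"
      by (simp add: exp_diff algebra_simps)
    also have "\<dots> \<le> exp x * \<bar>x - y\<bar>" by (intro mult_left_mono) auto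
    also have "\<dots> \<le> exp c * \<bar>x - y\<bar>" using that by (intro mult_right_mono) auto
    finally show ?thesis .
  qed
  show ?thesis using *[of x y] *[of y x] assms by (simp add: abs_minus_commute abs_le_iff)
qed

lemma norm_sub_sub_add_le:
  fixes a b c d :: "'a::real_normed_vector"
  shows "norm (a - b - c + d) \<le> norm a + norm b + norm c + norm d"
  using norm_triangle_ineq[of "a - b - c" d] norm_triangle_ineq4[of "a - b" c] norm_triangle_ineq4[of a b]
  by linarith

section \<open>Global Picard iteration for finite systems\<close>

lemma integral_from_0_has_vector_derivative:
  fixes h :: "real \<Rightarrow> 'a::banach"
  assumes "continuous_on {0..} h" "t \<ge> 0"
  shows "((\<lambda>t. integral {0..t} h) has_vector_derivative h t) (at t within {0..})"
proof -
  have "((\<lambda>t. integral {0..t} h) has_vector_derivative h t) (at t within {0..t+1})"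
    using assms by (intro integral_has_vector_derivative continuous_on_subset[OF assms(1)]) auto
  moreover have "at t within {0..t+1} = at t within {0..}"
    using assms(2) by (intro at_within_nhd[of t "{t-1<..<t+1}"]) auto
  ultimately show ?thesis by simp
qed

lemma has_vector_derivative_imp_continuous_on:
  assumes "\<And>t. t \<in> S \<Longrightarrow> (f has_vector_derivative f' t) (at t within S)"
  shows "continuous_on S f"
  using assms by (meson continuous_on_eq_continuous_within has_vector_derivative_continuous)

text \<open>States are functions on an index type of which only the finitely many coordinates in \<open>J\<close> move; this
  admits systems whose size is a variable.\<close>

primrec picard :: "'i set \<Rightarrow> (real \<Rightarrow> ('i \<Rightarrow> 'a::banach) \<Rightarrow> 'i \<Rightarrow> 'a) \<Rightarrow> ('i \<Rightarrow> 'a) \<Rightarrow> nat \<Rightarrow> real \<Rightarrow> 'i \<Rightarrow> 'a"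
  where
    "picard J f u0 0 = (\<lambda>t. u0)"
  | "picard J f u0 (Suc n) =
      (\<lambda>t j. if j \<in> J then u0 j + integral {0..t} (\<lambda>s. f s (picard J f u0 n s) j) else u0 j)"

text \<open>On \<open>{0..T}\<close> the iterates converge geometrically in the weighted norm with weight \<open>exp (- c t)\<close>,
  where \<open>c\<close> is twice the Lipschitz constant times the number of coordinates. The iterates themselves
  do not depend on \<open>T\<close>, hence neither does their limit, and the solution exists for all positive times
  even if the Lipschitz constant grows with \<open>T\<close>.\<close>

theorem picard_lindelof_global:
  fixes f :: "real \<Rightarrow> ('i \<Rightarrow> 'a::banach) \<Rightarrow> 'i \<Rightarrow> 'a"
  assumes fin: "finite J"
    and cont: "\<And>u j. j \<in> J \<Longrightarrow> (\<And>i. i \<in> J \<Longrightarrow> continuous_on {0..} (\<lambda>t. u t i)) \<Longrightarrow>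
      continuous_on {0..} (\<lambda>t. f t (u t) j)"
    and lip: "\<And>T. \<exists>L. \<forall>t\<in>{0..T}. \<forall>u v. \<forall>j\<in>J.
      norm (f t u j - f t v j) \<le> L * (\<Sum>i\<in>J. norm (u i - v i))"
  obtains U where "U 0 = u0"
    "\<And>t j. t \<ge> 0 \<Longrightarrow> j \<in> J \<Longrightarrow> ((\<lambda>s. U s j) has_vector_derivative f t (U t) j) (at t within {0..})"
    "\<And>t j. j \<notin> J \<Longrightarrow> U t j = u0 j"
proof -
  define x where "x = picard J f u0"
  have x0: "x 0 t = u0" for t by (simp add: x_def)
  have xS: "x (Suc n) t j = u0 j + integral {0..t} (\<lambda>s. f s (x n s) j)" if "j \<in> J" for n t j
    using that by (simp add: x_def)
  have xout: "x n t j = u0 j" if "j \<notin> J" for n t j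
    using that by (cases n) (simp_all add: x_def)
  have xinit: "x n 0 = u0" for n
    by (cases n) (auto simp: x_def)
  have xcont: "continuous_on {0..} (\<lambda>t. x n t j)" if "j \<in> J" for n j
    using that
  proof (induction n arbitrary: j)
    case 0
    then show ?case by (simp add: x0)
  next
    case (Suc n)
    have "continuous_on {0..} (\<lambda>t. f t (x n t) j)"
      using Suc by (intro cont) auto
    then have "continuous_on {0..} (\<lambda>t. integral {0..t} (\<lambda>s. f s (x n s) j))"
      by (intro has_vector_derivative_imp_continuous_on[OF integral_from_0_has_vector_derivative]) auto
    then show ?case using Suc.prems by (simp add: xS continuous_intros)
  qed
  have fcont: "continuous_on {0..} (\<lambda>t. f t (x n t) j)" if "j \<in> J" for n j
    using that xcont by (intro cont) auto
  have xder: "((\<lambda>t. x (Suc n) t j) has_vector_derivative f t (x n t) j) (at t within {0..})"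
    if "j \<in> J" "t \<ge> 0" for n t j
    using integral_from_0_has_vector_derivative[OF fcont[OF that(1), of n] that(2)] that(1)
    by (auto simp: xS intro!: derivative_eq_intros)
  define U where "U = (\<lambda>t j. u0 j + (\<Sum>n. x (Suc n) t j - x n t j))"
  have unif: "uniform_limit {0..T} (\<lambda>n t. x n t j) (\<lambda>t. U t j) sequentially"
    if "j \<in> J" for T j
  proof -
    obtain L0 where L0: "\<And>t u v j. t \<in> {0..T} \<Longrightarrow> j \<in> J \<Longrightarrow>
        norm (f t u j - f t v j) \<le> L0 * (\<Sum>i\<in>J. norm (u i - v i))"
      using lip[of T] by blast
    define L where "L = max L0 1"
    have L: "norm (f t u j - f t v j) \<le> L * (\<Sum>i\<in>J. norm (u i - v i))" if "t \<in> {0..T}" "j \<in> J" for t u v j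
      by (rule order_trans[OF L0[OF that] mult_right_mono]) (auto simp: L_def sum_nonneg)
    have "L > 0" by (simp add: L_def)
    define N where "N = real (card J)"
    have "N > 0" using fin \<open>j \<in> J\<close> by (auto simp: N_def card_gt_0_iff)
    define c where "c = 2 * N * L"
    have "c > 0" using \<open>L > 0\<close> \<open>N > 0\<close> by (simp add: c_def)
    obtain C where C: "\<And>t i. t \<in> {0..T} \<Longrightarrow> i \<in> J \<Longrightarrow> norm (x 1 t i - x 0 t i) \<le> C"
    proof -
      have "\<exists>C. \<forall>t\<in>{0..T}. norm (x 1 t i - x 0 t i) \<le> C" if "i \<in> J" for i
      proof -
        have "continuous_on {0..T} (\<lambda>t. x 1 t i - x 0 t i)"
          by (intro continuous_intros continuous_on_subset[OF xcont[OF that]]) auto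
        then have "bounded ((\<lambda>t. x 1 t i - x 0 t i) ` {0..T})"
          by (intro compact_imp_bounded compact_continuous_image) auto
        then show ?thesis by (auto simp: bounded_iff)
      qed
      then obtain C where "\<And>i t. i \<in> J \<Longrightarrow> t \<in> {0..T} \<Longrightarrow> norm (x 1 t i - x 0 t i) \<le> C i"
        by metis
      moreover have "C i \<le> Max (C ` J)" if "i \<in> J" for i using fin that by auto
      ultimately show ?thesis using that[of "Max (C ` J)"] by (meson order_trans)
    qed
    \<comment> \<open>With the weight, each integration gains a factor \<open>1 / c\<close>, so the Lipschitz step
      contracts by one half.\<close>
    have est: "norm (x (Suc n) t i - x n t i) \<le> C / 2 ^ n * exp (c * t)" if "t \<in> {0..T}" "i \<in> J" for n t i
      using that
    proof (induction n arbitrary: t i)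
      case 0
      have "0 \<le> C" using C[OF 0] norm_ge_zero by (meson order_trans)
      moreover have "1 \<le> exp (c * t)" using 0 \<open>c > 0\<close> by simp
      ultimately have "C \<le> C * exp (c * t)" by (simp add: mult_le_cancel_left1)
      then show ?case using C[OF 0] by simp
    next
      case (Suc n)
      define d where "d = (\<lambda>t. x (Suc (Suc n)) t i - x (Suc n) t i)"
      define G where "G = (\<lambda>t. C / 2 ^ Suc n * exp (c * t))"
      have "norm (d t - d 0) \<le> G t - G 0"
      proof (cases "t = 0")
        case False
        then have "0 < t" using Suc.prems by auto
        then show ?thesis
        proof (rule differentiable_bound_general)
          show "continuous_on {0..t} d" unfolding d_def
            by (intro continuous_intros continuous_on_subset[OF xcont[OF \<open>i \<in> J\<close>]]) auto
          show "continuous_on {0..t} G" unfolding G_def by (intro continuous_intros)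
          fix s assume s: "0 < s" "s < t"
          have at: "at s within {0..} = at s"
            using s by (intro at_within_interior) auto
          show "(d has_vector_derivative (f s (x (Suc n) s) i - f s (x n s) i)) (at s)"
            using xder[OF \<open>i \<in> J\<close>, of s] s unfolding d_def at
            by (intro has_vector_derivative_diff) auto
          show "(G has_vector_derivative (C / 2 ^ Suc n * c * exp (c * s))) (at s)"
            unfolding G_def has_real_derivative_iff_has_vector_derivative[symmetric]
            by (auto intro!: derivative_eq_intros)
          have sT: "s \<in> {0..T}" using s Suc.prems by auto
          have "norm (f s (x (Suc n) s) i - f s (x n s) i)
              \<le> L * (\<Sum>i\<in>J. norm (x (Suc n) s i - x n s i))"
            by (rule L[OF sT \<open>i \<in> J\<close>])
          also have "\<dots> \<le> L * (\<Sum>i\<in>J. C / 2 ^ n * exp (c * s))"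
            using \<open>L > 0\<close> Suc.IH[OF sT] by (intro mult_left_mono sum_mono) auto
          also have "\<dots> = C / 2 ^ Suc n * c * exp (c * s)"
            by (simp add: c_def N_def)
          finally show "norm (f s (x (Suc n) s) i - f s (x n s) i) \<le> \<dots>" .
        qed
      qed simp
      moreover have "d 0 = 0" by (simp add: d_def xinit)
      moreover have "0 \<le> G 0"
      proof -
        have "0 \<le> C" using C[OF Suc.prems] norm_ge_zero by (meson order_trans)
        then show ?thesis by (simp add: G_def)
      qed
      ultimately show ?case by (simp add: d_def G_def)
    qed
    have "uniform_limit {0..T} (\<lambda>n t. \<Sum>k<n. x (Suc k) t j - x k t j)
        (\<lambda>t. \<Sum>k. x (Suc k) t j - x k t j) sequentially"
    proof (rule Weierstrass_m_test)
      show "norm (x (Suc n) t j - x n t j) \<le> C * exp (c * T) * (1/2) ^ n" if "t \<in> {0..T}" for n t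
      proof -
        have "0 \<le> C" using C[OF that \<open>j \<in> J\<close>] norm_ge_zero by (meson order_trans)
        have "norm (x (Suc n) t j - x n t j) \<le> C / 2 ^ n * exp (c * t)"
          by (rule est[OF that \<open>j \<in> J\<close>])
        also have "\<dots> \<le> C / 2 ^ n * exp (c * T)"
          using that \<open>c > 0\<close> \<open>0 \<le> C\<close> by (intro mult_left_mono) auto
        finally show ?thesis by (simp add: power_one_over field_simps)
      qed
      show "summable (\<lambda>n. C * exp (c * T) * (1/2::real) ^ n)"
        by (intro summable_mult summable_geometric) auto
    qed
    then have "uniform_limit {0..T} (\<lambda>n t. u0 j + (\<Sum>k<n. x (Suc k) t j - x k t j)) (\<lambda>t. U t j) sequentially"
      unfolding U_def by (intro uniform_limit_intros)
    then show ?thesis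
      by (simp add: sum_lessThan_telescope[of "\<lambda>k. x k _ j"] x0)
  qed
  have Ucont: "continuous_on {0..} (\<lambda>t. U t j)" if "j \<in> J" for j
    unfolding continuous_on_eq_continuous_within
  proof
    fix t :: real assume "t \<in> {0..}"
    then have "0 \<le> t" by simp
    have "continuous_on {0..t+1} (\<lambda>t. U t j)"
      by (rule uniform_limit_theorem[OF _ unif[OF that, of "t+1"]])
         (auto intro!: always_eventually continuous_on_subset[OF xcont[OF that]])
    moreover have "at t within {0..t+1} = at t within {0..}"
      using \<open>0 \<le> t\<close> by (intro at_within_nhd[of t "{t-1<..<t+1}"]) auto
    ultimately show "continuous (at t within {0..}) (\<lambda>t. U t j)"
      using \<open>0 \<le> t\<close> by (auto simp: continuous_on_eq_continuous_within dest!: bspec[of _ _ t])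
  qed
  have Uint: "U t j = u0 j + integral {0..t} (\<lambda>s. f s (U s) j)" if "j \<in> J" "t \<ge> 0" for t j
  proof -
    note jJ = that(1)
    obtain L0 where L0: "\<And>s u v j. s \<in> {0..t} \<Longrightarrow> j \<in> J \<Longrightarrow>
        norm (f s u j - f s v j) \<le> L0 * (\<Sum>i\<in>J. norm (u i - v i))"
      using lip[of t] by blast
    have fu: "uniform_limit {0..t} (\<lambda>n s. f s (x n s) j) (\<lambda>s. f s (U s) j) sequentially"
    proof -
      have sums: "uniform_limit {0..t} (\<lambda>n s. \<Sum>i\<in>I. norm (x n s i - U s i))
          (\<lambda>s. \<Sum>i\<in>I. norm (U s i - U s i)) sequentially" if "I \<subseteq> J" for I
        using finite_subset[OF that fin] that
      proof (induction I rule: finite_induct)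
        case (insert i I)
        then have "uniform_limit {0..t} (\<lambda>n s. norm (x n s i - U s i) + (\<Sum>i\<in>I. norm (x n s i - U s i)))
            (\<lambda>s. norm (U s i - U s i) + (\<Sum>i\<in>I. norm (U s i - U s i))) sequentially"
          by (intro uniform_limit_add uniform_limit_norm uniform_limit_minus uniform_limit_const unif) auto
        then show ?case by (simp only: sum.insert[OF insert.hyps])
      qed (simp add: uniform_limit_const)
      have "uniform_limit {0..t} (\<lambda>n s. L0 * (\<Sum>i\<in>J. norm (x n s i - U s i))) (\<lambda>s. L0 * (\<Sum>i\<in>J. norm (U s i - U s i))) sequentially"
        by (intro bounded_linear.uniform_limit[OF bounded_linear_mult_right] sums) simp
      then have ev: "\<forall>\<^sub>F n in sequentially. \<forall>s\<in>{0..t}. L0 * (\<Sum>i\<in>J. norm (x n s i - U s i)) < e" if "e > 0" for e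
        using that unfolding uniform_limit_iff by (auto simp: dist_real_def abs_less_iff elim!: allE[of _ e] eventually_mono)
      show ?thesis
        unfolding uniform_limit_iff dist_norm
      proof (intro allI impI)
        fix e :: real assume "e > 0"
        show "\<forall>\<^sub>F n in sequentially. \<forall>s\<in>{0..t}. norm (f s (x n s) j - f s (U s) j) < e"
          using ev[OF \<open>e > 0\<close>] by eventually_elim (use L0[OF _ that(1)] in \<open>blast intro: le_less_trans\<close>)
      qed
    qed
    obtain I K where IK: "\<And>n. ((\<lambda>s. f s (x n s) j) has_integral I n) {0..t}"
        "((\<lambda>s. f s (U s) j) has_integral K) {0..t}" "I \<longlonglongrightarrow> K"
    proof (rule uniform_limit_integral[OF fu])
      show "continuous_on {0..t} (\<lambda>s. f s (x n s) j)" for n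
        by (rule continuous_on_subset[OF fcont[OF jJ]]) auto
    qed auto
    have "(\<lambda>n. x (Suc n) t j) \<longlonglongrightarrow> u0 j + K"
      unfolding xS[OF that(1)] integral_unique[OF IK(1)] by (intro tendsto_intros IK(3))
    moreover have "(\<lambda>n. x (Suc n) t j) \<longlonglongrightarrow> U t j"
      using tendsto_uniform_limitI[OF unif[OF that(1), of t], of t] that(2)
      by (auto intro: LIMSEQ_Suc)
    ultimately show ?thesis using IK(2) LIMSEQ_unique by (metis integral_unique)
  qed
  show ?thesis
  proof (rule that[of U])
    show "U t j = u0 j" if "j \<notin> J" for t j
      using that by (simp add: U_def xout)
    then show "U 0 = u0"
      using Uint[of _ 0] by (intro ext) (metis add.right_neutral integral_refl order_refl atLeastAtMost_singleton box_real(2) cbox_idem)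
    fix t :: real and j assume tj: "t \<ge> 0" "j \<in> J"
    have "continuous_on {0..} (\<lambda>t. f t (U t) j)"
      using tj Ucont by (intro cont) auto
    then have "((\<lambda>t. u0 j + integral {0..t} (\<lambda>s. f s (U s) j)) has_vector_derivative f t (U t) j) (at t within {0..})"
      using integral_from_0_has_vector_derivative tj by (auto intro!: derivative_eq_intros)
    then show "((\<lambda>s. U s j) has_vector_derivative f t (U t) j) (at t within {0..})"
      by (rule has_vector_derivative_transform[rotated 2]) (use tj Uint in auto)
  qed
qed

section \<open>The cut-off power nonlinearity\<close>

text \<open>For \<open>\<bar>v\<bar> \<le> \<bar>u\<bar>\<close> the difference is \<open>h(u) (u - v) + (h(u) - h(v)) v\<close>. The factor \<open>v\<close> in the second term
  compensates the possible blow-up of the derivative of \<open>z powr p\<close> at 0 when \<open>p < 1\<close>, so the same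
  constant works for all positive \<open>p\<close>.\<close>

lemma min_powr_lipschitz:
  fixes u v :: complex
  assumes "p > 0" "R \<ge> 0"
  shows "cmod (complex_of_real (min (cmod u) R powr p) * u - complex_of_real (min (cmod v) R powr p) * v)
    \<le> (1 + p) * R powr p * cmod (u - v)"
proof -
  define h where "h = (\<lambda>w. min (cmod w) R powr p)"
  have main: "cmod (of_real (h u) * u - of_real (h v) * v) \<le> (1 + p) * R powr p * cmod (u - v)"
    if le: "cmod v \<le> cmod u" for u v
  proof -
    have "(h u - h v) * cmod v \<le> p * R powr p * cmod (u - v)"
    proof (cases "h u = h v \<or> v = 0")
      case True
      then show ?thesis using assms by auto
    next
      case False
      define x y where "x = min (cmod u) R" and "y = min (cmod v) R"
      have "cmod v < R"
      proof (rule ccontr)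
        assume "\<not> cmod v < R"
        then have "min (cmod u) R = R" "min (cmod v) R = R" using le by auto
        then show False using False by (simp add: h_def)
      qed
      then have y: "y = cmod v" by (simp add: y_def)
      have "0 < y" using False y by simp
      have "y \<le> x" using le by (simp add: x_def y_def)
      moreover have "x \<noteq> y" using False by (auto simp: h_def x_def y_def)
      ultimately have "y < x" by simp
      obtain z where z: "y < z" "z < x" "x powr p - y powr p = (x - y) * (p * z powr (p - 1))"
      proof -
        have "((\<lambda>z. z powr p) has_real_derivative p * z powr (p - 1)) (at z)" if "y \<le> z" for z
          using that \<open>0 < y\<close> by (intro has_real_derivative_powr) auto
        then show ?thesis
          using MVT2[OF \<open>y < x\<close>, of "\<lambda>z. z powr p" "\<lambda>z. p * z powr (p - 1)"] that by blast
      qed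
      have "0 < z" using \<open>0 < y\<close> z by simp
      have "(h u - h v) * cmod v = (x - y) * (p * z powr (p - 1)) * y"
        using z(3) y by (simp add: h_def x_def y_def)
      also have "\<dots> \<le> (x - y) * (p * z powr (p - 1)) * z"
        using z \<open>y < x\<close> assms by (intro mult_left_mono) auto
      also have "\<dots> = (x - y) * (p * z powr p)"
        using \<open>0 < z\<close> by (simp add: powr_diff)
      also have "\<dots> \<le> (x - y) * (p * R powr p)"
        using z \<open>0 < z\<close> \<open>y < x\<close> assms by (intro mult_left_mono powr_mono2) (auto simp: x_def)
      also have "\<dots> \<le> cmod (u - v) * (p * R powr p)"
      proof (rule mult_right_mono)
        have "x - y \<le> cmod u - cmod v" using y by (simp add: x_def)
        also have "\<dots> \<le> cmod (u - v)" by (rule norm_triangle_ineq2)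
        finally show "x - y \<le> cmod (u - v)" .
      qed (use assms in auto)
      finally show ?thesis by (simp add: mult_ac)
    qed
    moreover have "h v \<le> h u" using le assms by (auto simp: h_def intro!: powr_mono2)
    moreover have "h u * cmod (u - v) \<le> R powr p * cmod (u - v)"
      using assms by (intro mult_right_mono) (auto simp: h_def intro!: powr_mono2)
    moreover have "of_real (h u) * u - of_real (h v) * v = of_real (h u) * (u - v) + of_real (h u - h v) * v"
      by (simp add: algebra_simps)
    moreover have "cmod \<dots> \<le> h u * cmod (u - v) + \<bar>h u - h v\<bar> * cmod v"
      by (rule norm_triangle_le) (simp add: norm_mult h_def del: of_real_diff)
    ultimately show ?thesis by (simp add: algebra_simps)
  qed
  show ?thesis
  proof (cases "cmod v \<le> cmod u")
    case True
    then show ?thesis using main[of v u] by (simp add: h_def)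
  next
    case False
    then show ?thesis using main[of u v] by (simp add: h_def norm_minus_commute)
  qed
qed

section \<open>Geometry of the phase space\<close>

definition sqnorm_X :: "nat \<Rightarrow> (int \<Rightarrow> complex) \<Rightarrow> real" where
  "sqnorm_X m u = (\<Sum>j\<in>{- int m..int m}. (cmod (u j))\<^sup>2)"

lemma norm_X_eq_sqrt: "norm_X m u = sqrt (sqnorm_X m u)"
  by (simp add: norm_X_def sqnorm_X_def L2_set_def)

lemma sqnorm_X_nonneg [simp]: "sqnorm_X m u \<ge> 0"
  by (simp add: sqnorm_X_def sum_nonneg)

lemma cmod_le_sqrt_sqnorm_X: "j \<in> {- int m..int m} \<Longrightarrow> cmod (u j) \<le> sqrt (sqnorm_X m u)"
  unfolding sqnorm_X_def by (intro real_le_rsqrt member_le_sum) auto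

lemma eq_on_X:
  assumes "u \<in> X m" "v \<in> X m" "\<And>j. j \<in> {- int m..int m} \<Longrightarrow> u j = v j"
  shows "u = v"
proof
  fix j show "u j = v j"
    using assms by (cases "\<bar>j\<bar> > int m") (auto simp: X_def abs_le_iff not_less)
qed

lemma sqnorm_X_has_derivative:
  assumes "\<And>j. j \<in> {- int m..int m} \<Longrightarrow> ((\<lambda>s. U s j) has_vector_derivative U' j) (at t within S)"
  shows "((\<lambda>s. sqnorm_X m (U s)) has_real_derivative
    (\<Sum>j\<in>{- int m..int m}. 2 * Re (cnj (U t j) * U' j))) (at t within S)"
proof -
  have "((\<lambda>s. (cmod (U s j))\<^sup>2) has_real_derivative 2 * Re (cnj (U t j) * U' j)) (at t within S)"
    if "j \<in> {- int m..int m}" for j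
  proof -
    have "((\<lambda>s. U s j \<bullet> U s j) has_vector_derivative (U t j \<bullet> U' j + U' j \<bullet> U t j)) (at t within S)"
      by (rule bounded_bilinear.has_vector_derivative[OF bounded_bilinear_inner assms[OF that] assms[OF that]])
    then show ?thesis
      by (simp add: has_real_derivative_iff_has_vector_derivative power2_norm_eq_inner inner_complex_def algebra_simps)
  qed
  then show ?thesis
    unfolding sqnorm_X_def by (intro DERIV_sum)
qed

text \<open>Some coordinate carries at least the average of the squared moduli, and its contribution alone
  already exceeds the left-hand side.\<close>

lemma sum_powr_ge_sqnorm_X:
  assumes "p > 0"
  shows "(sqnorm_X m u / real (card {- int m..int m})) powr (1 + p / 2)
    \<le> (\<Sum>j\<in>{- int m..int m}. cmod (u j) powr p * (cmod (u j))\<^sup>2)"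
proof -
  let ?J = "{- int m..int m}"
  have "\<exists>j\<in>?J. sqnorm_X m u / real (card ?J) \<le> (cmod (u j))\<^sup>2"
  proof (rule ccontr)
    assume "\<not> ?thesis"
    then have "sqnorm_X m u < (\<Sum>j\<in>?J. sqnorm_X m u / real (card ?J))"
      unfolding sqnorm_X_def[of m u] by (intro sum_strict_mono) (auto simp: sqnorm_X_def not_le)
    then show False by simp
  qed
  then obtain j where j: "j \<in> ?J" "sqnorm_X m u / real (card ?J) \<le> (cmod (u j))\<^sup>2" by blast
  have "(sqnorm_X m u / real (card ?J)) powr (1 + p / 2) \<le> ((cmod (u j))\<^sup>2) powr (1 + p / 2)"
    using j(2) assms by (intro powr_mono2) auto
  also have "\<dots> = cmod (u j) powr p * (cmod (u j))\<^sup>2"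
    using assms by (cases "u j = 0") (auto simp: powr_add powr_powr mult.commute simp flip: powr_numeral)
  also have "\<dots> \<le> (\<Sum>j\<in>?J. cmod (u j) powr p * (cmod (u j))\<^sup>2)"
    using j(1) by (intro member_le_sum[of j ?J "\<lambda>j. cmod (u j) powr p * (cmod (u j))\<^sup>2"]) auto
  finally show ?thesis .
qed

lemma d_X_eq_sqrt: "d_X m x y = sqrt (sqnorm_X m (\<lambda>j. x j - y j))"
  by (simp add: d_X_def norm_X_eq_sqrt)

lemma d_X_nonneg [simp]: "0 \<le> d_X m x y"
  by (simp add: d_X_eq_sqrt)

lemma point_dist_X_triangle:
  assumes "x \<in> X m" "y \<in> X m" "B \<subseteq> X m"
  shows "point_dist_X m x B \<le> ennreal (d_X m x y) + point_dist_X m y B"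
proof (rule ennreal_le_epsilon)
  fix e :: real
  assume fin: "ennreal (d_X m x y) + point_dist_X m y B < top" and e: "0 < e"
  have "point_dist_X m y B < point_dist_X m y B + ennreal e"
    using fin e by (cases "point_dist_X m y B") (auto simp flip: ennreal_plus intro!: ennreal_lessI)
  then obtain b where b: "b \<in> B" "ennreal (d_X m y b) < point_dist_X m y B + ennreal e"
    unfolding point_dist_X_def by (auto simp: INF_less_iff)
  have "point_dist_X m x B \<le> ennreal (d_X m x b)"
    unfolding point_dist_X_def by (rule INF_lower[OF b(1)])
  also have "d_X m x b \<le> d_X m x y + d_X m y b"
    using Metric_space.triangle[OF Metric_space_X] assms b(1) by blast
  then have "ennreal (d_X m x b) \<le> ennreal (d_X m x y) + ennreal (d_X m y b)"
    by (simp flip: ennreal_plus)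
  also have "\<dots> \<le> ennreal (d_X m x y) + (point_dist_X m y B + ennreal e)"
    using b(2) by (intro add_left_mono) simp
  finally show "point_dist_X m x B \<le> ennreal (d_X m x y) + point_dist_X m y B + ennreal e"
    by (simp add: add.assoc)
qed

lemma point_dist_X_UN: "point_dist_X m x (\<Union>i\<in>I. B i) = (INF i\<in>I. point_dist_X m x (B i))"
  unfolding point_dist_X_def
  by (intro antisym INF_greatest) (auto intro: INF_lower INF_lower2 intro!: INF_greatest)

lemma closure_of_X:
  "top_X m closure_of S = {x \<in> X m. \<forall>r>0. \<exists>y\<in>S. y \<in> X m \<and> d_X m x y < r}"
  by (auto simp: Metric_space.metric_closure_of[OF Metric_space_X] Metric_space.in_mball[OF Metric_space_X])

lemma subset_closure_of_X: "S \<subseteq> X m \<Longrightarrow> S \<subseteq> top_X m closure_of S"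
  by (intro closure_of_subset) (simp add: Metric_space.topspace_mtopology[OF Metric_space_X])

lemma point_dist_X_closure:
  assumes "S \<subseteq> X m" "x \<in> X m"
  shows "point_dist_X m x (top_X m closure_of S) = point_dist_X m x S"
proof (rule antisym)
  show "point_dist_X m x (top_X m closure_of S) \<le> point_dist_X m x S"
    unfolding point_dist_X_def by (rule INF_superset_mono[OF subset_closure_of_X[OF assms(1)]]) simp
  show "point_dist_X m x S \<le> point_dist_X m x (top_X m closure_of S)"
    unfolding point_dist_X_def[of m x "top_X m closure_of S"]
  proof (rule INF_greatest)
    fix c assume c: "c \<in> top_X m closure_of S"
    have "point_dist_X m c S \<le> 0"
    proof (rule ennreal_le_epsilon)
      fix e :: real assume "0 < e"
      then obtain s where "s \<in> S" "d_X m c s < e" using c by (auto simp: closure_of_X)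
      then show "point_dist_X m c S \<le> 0 + ennreal e"
        unfolding point_dist_X_def by (auto intro!: INF_lower2[of s] ennreal_leI)
    qed
    then show "point_dist_X m x S \<le> ennreal (d_X m x c)"
      using point_dist_X_triangle[OF assms(2) _ assms(1), of c] c by (simp add: closure_of_X)
  qed
qed

lemma norm_X_closure_le:
  assumes "S \<subseteq> X m" "\<And>y. y \<in> S \<Longrightarrow> norm_X m y \<le> c" "x \<in> top_X m closure_of S"
  shows "norm_X m x \<le> c"
proof (rule field_le_epsilon)
  fix e :: real assume "0 < e"
  then obtain y where y: "y \<in> S" "d_X m x y < e" using assms(3) by (auto simp: closure_of_X)
  have zero: "(\<lambda>_. 0) \<in> X m" by (simp add: X_def)
  have "x \<in> X m" using assms(3) by (simp add: closure_of_X)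
  then have "d_X m x (\<lambda>_. 0) \<le> d_X m x y + d_X m y (\<lambda>_. 0)"
    using Metric_space.triangle[OF Metric_space_X] assms(1) y(1) zero by blast
  then show "norm_X m x \<le> c + e" using assms(2)[OF y(1)] y(2) by (simp add: d_X_def)
qed

section \<open>The periodic discrete Laplacian\<close>

definition cyclic_succ :: "nat \<Rightarrow> int \<Rightarrow> int" where
  "cyclic_succ m j = (if j = int m then - int m else j + 1)"

definition cyclic_pred :: "nat \<Rightarrow> int \<Rightarrow> int" where
  "cyclic_pred m j = (if j = - int m then int m else j - 1)"

lemma cyclic_succ_in: "j \<in> {- int m..int m} \<Longrightarrow> cyclic_succ m j \<in> {- int m..int m}"
  by (auto simp: cyclic_succ_def)

lemma cyclic_pred_in: "j \<in> {- int m..int m} \<Longrightarrow> cyclic_pred m j \<in> {- int m..int m}"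
  by (auto simp: cyclic_pred_def)

lemma sum_cyclic_shift:
  "(\<Sum>j\<in>{- int m..int m}. h (cyclic_pred m j) j) = (\<Sum>j\<in>{- int m..int m}. h j (cyclic_succ m j))"
  by (rule sum.reindex_bij_witness[of _ "cyclic_succ m" "cyclic_pred m"]) (auto simp: cyclic_succ_def cyclic_pred_def)

lemma Lap_eq: "Lap m u j = 2 * u j - u (cyclic_pred m j) - u (cyclic_succ m j)"
  by (simp add: Lap_def cyclic_succ_def cyclic_pred_def)

text \<open>The two shifted terms of the quadratic form are complex conjugates of each other after a cyclic change
  of summation index, so the form is real. This is why \<open>\<mu>\<close> does not contribute to the energy balance.\<close>

lemma Lap_form:
  "(\<Sum>j\<in>{- int m..int m}. cnj (u j) * Lap m u j) =
     complex_of_real (\<Sum>j\<in>{- int m..int m}. 2 * (cmod (u j))\<^sup>2 - 2 * Re (cnj (u j) * u (cyclic_succ m j)))"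
proof -
  let ?J = "{- int m..int m}"
  have *: "(\<Sum>j\<in>?J. cnj (u j) * u (cyclic_pred m j)) = (\<Sum>j\<in>?J. cnj (u (cyclic_succ m j)) * u j)"
    by (rule sum_cyclic_shift[of "\<lambda>i j. cnj (u j) * u i"])
  have "(\<Sum>j\<in>?J. cnj (u j) * Lap m u j) =
      (\<Sum>j\<in>?J. 2 * (cnj (u j) * u j)) - (\<Sum>j\<in>?J. cnj (u j) * u (cyclic_pred m j))
      - (\<Sum>j\<in>?J. cnj (u j) * u (cyclic_succ m j))"
    by (simp add: Lap_eq algebra_simps sum.distrib sum_subtractf)
  also have "\<dots> = (\<Sum>j\<in>?J. 2 * (cnj (u j) * u j) - (cnj (u (cyclic_succ m j)) * u j + cnj (u j) * u (cyclic_succ m j)))"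
    by (simp add: * sum.distrib sum_subtractf)
  also have "\<dots> = (\<Sum>j\<in>?J. complex_of_real (2 * (cmod (u j))\<^sup>2 - 2 * Re (cnj (u j) * u (cyclic_succ m j))))"
  proof (rule sum.cong)
    fix j
    have "cnj (u j) * u j = complex_of_real ((cmod (u j))\<^sup>2)"
      by (metis complex_norm_square mult.commute of_real_power)
    moreover have "cnj (u (cyclic_succ m j)) * u j + cnj (u j) * u (cyclic_succ m j) =
        complex_of_real (2 * Re (cnj (u j) * u (cyclic_succ m j)))"
      by (simp add: complex_eq_iff algebra_simps)
    ultimately show "2 * (cnj (u j) * u j) - (cnj (u (cyclic_succ m j)) * u j + cnj (u j) * u (cyclic_succ m j)) =
        complex_of_real (2 * (cmod (u j))\<^sup>2 - 2 * Re (cnj (u j) * u (cyclic_succ m j)))"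
      by simp
  qed simp
  finally show ?thesis by simp
qed

text \<open>The constant 4 is the upper bound for the spectrum of the discrete Laplacian, which is where the
  condition \<open>4 \<lambda> < \<gamma>\<close> comes from.\<close>

lemma Re_Lap_form_le:
  assumes "lam \<ge> 0"
  shows "(\<Sum>j\<in>{- int m..int m}. Re (cnj (u j) * (Complex lam \<mu> * Lap m u j))) \<le> 4 * lam * sqnorm_X m u"
proof -
  let ?J = "{- int m..int m}"
  have shifted: "(\<Sum>j\<in>?J. (cmod (u (cyclic_succ m j)))\<^sup>2) = sqnorm_X m u"
    unfolding sqnorm_X_def by (rule sum_cyclic_shift[of "\<lambda>i j. (cmod (u j))\<^sup>2", symmetric])
  have "(\<Sum>j\<in>?J. 2 * (cmod (u j))\<^sup>2 - 2 * Re (cnj (u j) * u (cyclic_succ m j)))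
      \<le> (\<Sum>j\<in>?J. 2 * (cmod (u j))\<^sup>2 + ((cmod (u j))\<^sup>2 + (cmod (u (cyclic_succ m j)))\<^sup>2))"
  proof (rule sum_mono)
    fix j
    have "- (2 * Re (cnj (u j) * u (cyclic_succ m j))) \<le> 2 * (cmod (u j) * cmod (u (cyclic_succ m j)))"
      using abs_Re_le_cmod[of "cnj (u j) * u (cyclic_succ m j)"] by (simp add: norm_mult)
    also have "\<dots> \<le> (cmod (u j))\<^sup>2 + (cmod (u (cyclic_succ m j)))\<^sup>2"
      using sum_squares_bound[of "cmod (u j)" "cmod (u (cyclic_succ m j))"] by simp
    finally show "2 * (cmod (u j))\<^sup>2 - 2 * Re (cnj (u j) * u (cyclic_succ m j))
      \<le> 2 * (cmod (u j))\<^sup>2 + ((cmod (u j))\<^sup>2 + (cmod (u (cyclic_succ m j)))\<^sup>2)"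
      by simp
  qed
  also have "\<dots> = 2 * sqnorm_X m u + (sqnorm_X m u + (\<Sum>j\<in>?J. (cmod (u (cyclic_succ m j)))\<^sup>2))"
    by (simp only: sqnorm_X_def sum.distrib sum_distrib_left)
  also have "\<dots> = 4 * sqnorm_X m u"
    by (simp only: shifted)
  finally have form: "(\<Sum>j\<in>?J. 2 * (cmod (u j))\<^sup>2 - 2 * Re (cnj (u j) * u (cyclic_succ m j))) \<le> 4 * sqnorm_X m u" .
  have "(\<Sum>j\<in>?J. Re (cnj (u j) * (Complex lam \<mu> * Lap m u j))) =
      Re (Complex lam \<mu> * (\<Sum>j\<in>?J. cnj (u j) * Lap m u j))"
    by (simp only: sum_distrib_left Re_sum) (simp only: mult.left_commute)
  also have "\<dots> = lam * (\<Sum>j\<in>?J. 2 * (cmod (u j))\<^sup>2 - 2 * Re (cnj (u j) * u (cyclic_succ m j)))"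
    unfolding Lap_form by (simp only: times_complex.sel complex_of_real_def complex.sel)
  also have "\<dots> \<le> lam * (4 * sqnorm_X m u)"
    using form assms by (rule mult_left_mono)
  finally show ?thesis by (simp add: mult_ac)
qed

section \<open>The truncated equation and its energy balance\<close>

locale truncated_lattice =
  fixes lam \<gamma> k p \<mu> \<beta> \<nu> :: real and g :: "int \<Rightarrow> complex" and m :: nat
  assumes lam_pos: "lam > 0" and k_pos: "k > 0" and p_pos: "p > 0" and gap: "4 * lam < \<gamma>"
begin

definition \<delta> :: real where "\<delta> = \<gamma> - 4 * lam"

lemma \<delta>_pos: "\<delta> > 0" using gap by (simp add: \<delta>_def)

text \<open>The right-hand side with \<open>\<bar>u\<bar>\<^sup>p\<close> replaced by a general weight \<open>\<psi> t \<bar>u\<bar>\<close> and the noise by a function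
  \<open>y\<close>. It covers the equation itself and its cut-off versions, which share the energy estimates.\<close>

definition field ::
  "(real \<Rightarrow> real \<Rightarrow> real) \<Rightarrow> real \<Rightarrow> (real \<Rightarrow> real) \<Rightarrow> real \<Rightarrow> (int \<Rightarrow> complex) \<Rightarrow> int \<Rightarrow> complex" where
  "field \<psi> b y t u j =
     Complex lam \<mu> * Lap m u j - Complex \<gamma> \<beta> * u j
     - Complex k \<nu> * complex_of_real (exp (p * b * y t)) * (complex_of_real (\<psi> t (cmod (u j))) * u j)
     + complex_of_real (exp (- b * y t)) * g j + complex_of_real (b * y t) * u j"

abbreviation full :: "real \<Rightarrow> real \<Rightarrow> real" where "full \<equiv> \<lambda>t r. r powr p"

abbreviation cut :: "(real \<Rightarrow> real) \<Rightarrow> real \<Rightarrow> real \<Rightarrow> real" where "cut R \<equiv> \<lambda>t r. min r (R t) powr p"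

lemma rhs_eq_field: "rhs lam \<mu> \<gamma> \<beta> k \<nu> p g m b \<omega> = field full b (\<lambda>t. OU (shift t \<omega>))"
  by (intro ext) (simp add: rhs_def field_def)

lemma field_cut_eq_full:
  assumes "cmod (u j) \<le> R t"
  shows "field (cut R) b y t u j = field full b y t u j"
  using assms by (simp add: field_def)

text \<open>The energy balance: half of the dissipation rate \<open>2 \<delta>\<close> is spent on the forcing by Young's inequality,
  and the weight \<open>\<psi>\<close> contributes a damping term whose coefficient involves only the real part \<open>k\<close>.\<close>

lemma dissipation:
  "(\<Sum>j\<in>{- int m..int m}. 2 * Re (cnj (u j) * field \<psi> b y t u j))
    \<le> (- \<delta> + 2 * b * y t) * sqnorm_X m u + (exp (- b * y t))\<^sup>2 / \<delta> * sqnorm_X m g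
      - 2 * k * exp (p * b * y t) * (\<Sum>j\<in>{- int m..int m}. \<psi> t (cmod (u j)) * (cmod (u j))\<^sup>2)"
proof -
  let ?J = "{- int m..int m}"
  define h c d where "h = exp (- b * y t)" and "c = b * y t" and "d = 2 * k * exp (p * b * y t)"
  have "2 * Re (cnj (u j) * field \<psi> b y t u j) \<le>
      2 * Re (cnj (u j) * (Complex lam \<mu> * Lap m u j))
      + (- 2 * \<gamma> + \<delta> + 2 * c) * (cmod (u j))\<^sup>2 + h\<^sup>2 / \<delta> * (cmod (g j))\<^sup>2
      - d * (\<psi> t (cmod (u j)) * (cmod (u j))\<^sup>2)" for j
  proof -
    define w where "w = exp (p * b * y t) * \<psi> t (cmod (u j))"
    have sq: "complex_of_real ((cmod (u j))\<^sup>2) = u j * cnj (u j)"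
      by (rule complex_norm_square)
    have "cnj (u j) * field \<psi> b y t u j =
        cnj (u j) * (Complex lam \<mu> * Lap m u j) - Complex \<gamma> \<beta> * of_real ((cmod (u j))\<^sup>2)
        - Complex k \<nu> * of_real (w * (cmod (u j))\<^sup>2) + of_real h * (cnj (u j) * g j)
        + of_real (c * (cmod (u j))\<^sup>2)"
      by (simp only: field_def w_def h_def c_def of_real_mult sq) (simp only: algebra_simps)
    then have "Re (cnj (u j) * field \<psi> b y t u j) =
        Re (cnj (u j) * (Complex lam \<mu> * Lap m u j)) - \<gamma> * (cmod (u j))\<^sup>2
        - k * (w * (cmod (u j))\<^sup>2) + h * Re (cnj (u j) * g j) + c * (cmod (u j))\<^sup>2"
      by simp
    moreover have "2 * (k * (w * (cmod (u j))\<^sup>2)) = d * (\<psi> t (cmod (u j)) * (cmod (u j))\<^sup>2)"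
      by (simp add: w_def d_def)
    moreover have "2 * (h * Re (cnj (u j) * g j)) \<le> \<delta> * (cmod (u j))\<^sup>2 + h\<^sup>2 / \<delta> * (cmod (g j))\<^sup>2"
    proof -
      have "Re (cnj (u j) * g j) \<le> cmod (u j) * cmod (g j)"
        using complex_Re_le_cmod[of "cnj (u j) * g j"] by (simp add: norm_mult)
      then have "h * Re (cnj (u j) * g j) \<le> h * (cmod (u j) * cmod (g j))"
        by (intro mult_left_mono) (auto simp: h_def)
      moreover have "2 * (h * (cmod (u j) * cmod (g j))) \<le> \<delta> * (cmod (u j))\<^sup>2 + h\<^sup>2 / \<delta> * (cmod (g j))\<^sup>2"
      proof -
        have "0 \<le> (\<delta> * cmod (u j) - h * cmod (g j))\<^sup>2 / \<delta>" using \<delta>_pos by simp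
        also have "\<dots> = \<delta> * (cmod (u j))\<^sup>2 + h\<^sup>2 / \<delta> * (cmod (g j))\<^sup>2 - 2 * (h * (cmod (u j) * cmod (g j)))"
          using \<delta>_pos by (simp add: power2_eq_square field_simps)
        finally show ?thesis by simp
      qed
      ultimately show ?thesis by linarith
    qed
    moreover have "(- 2 * \<gamma> + \<delta> + 2 * c) * (cmod (u j))\<^sup>2 =
        \<delta> * (cmod (u j))\<^sup>2 - 2 * (\<gamma> * (cmod (u j))\<^sup>2) + 2 * (c * (cmod (u j))\<^sup>2)"
      by (simp only: algebra_simps)
    ultimately show ?thesis by linarith
  qed
  then have "(\<Sum>j\<in>?J. 2 * Re (cnj (u j) * field \<psi> b y t u j)) \<le>
      (\<Sum>j\<in>?J. 2 * Re (cnj (u j) * (Complex lam \<mu> * Lap m u j))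
      + (- 2 * \<gamma> + \<delta> + 2 * c) * (cmod (u j))\<^sup>2 + h\<^sup>2 / \<delta> * (cmod (g j))\<^sup>2
      - d * (\<psi> t (cmod (u j)) * (cmod (u j))\<^sup>2))"
    by (rule sum_mono)
  also have "\<dots> = 2 * (\<Sum>j\<in>?J. Re (cnj (u j) * (Complex lam \<mu> * Lap m u j)))
      + (- 2 * \<gamma> + \<delta> + 2 * c) * sqnorm_X m u + h\<^sup>2 / \<delta> * sqnorm_X m g
      - d * (\<Sum>j\<in>?J. \<psi> t (cmod (u j)) * (cmod (u j))\<^sup>2)"
    by (simp only: sqnorm_X_def sum.distrib sum_subtractf sum_distrib_left)
  also have "\<dots> \<le> 2 * (4 * lam * sqnorm_X m u)
      + (- 2 * \<gamma> + \<delta> + 2 * c) * sqnorm_X m u + h\<^sup>2 / \<delta> * sqnorm_X m g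
      - d * (\<Sum>j\<in>?J. \<psi> t (cmod (u j)) * (cmod (u j))\<^sup>2)"
    using Re_Lap_form_le[of lam u \<mu> m] lam_pos by simp
  also have "\<dots> = (- \<delta> + 2 * c) * sqnorm_X m u + h\<^sup>2 / \<delta> * sqnorm_X m g
      - d * (\<Sum>j\<in>?J. \<psi> t (cmod (u j)) * (cmod (u j))\<^sup>2)"
    by (simp add: \<delta>_def algebra_simps)
  finally show ?thesis by (simp add: h_def c_def d_def mult.assoc)
qed

text \<open>Here the damping is discarded. The growth rate \<open>\<alpha>\<close> may exceed the actual one, so that it can be chosen
  constant on bounded time intervals.\<close>

lemma energy_growth:
  assumes sol: "solves m (field \<psi> b y) u0 U" and \<psi>: "\<And>t r. \<psi> t r \<ge> 0" and t: "0 \<le> t"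
    and E: "\<And>x. x \<in> {0..t} \<Longrightarrow> (E has_real_derivative \<alpha> x) (at x within {0..t})"
    and B: "\<And>x. x \<in> {0..t} \<Longrightarrow> (B has_real_derivative B' x) (at x within {0..t})"
    and \<alpha>: "\<And>x. x \<in> {0..t} \<Longrightarrow> - \<delta> + 2 * b * y x \<le> \<alpha> x"
    and B': "\<And>x. x \<in> {0..t} \<Longrightarrow> exp (- E x) * ((exp (- b * y x))\<^sup>2 / \<delta> * sqnorm_X m g) \<le> B' x"
  shows "exp (- E t) * sqnorm_X m (U t) - B t \<le> exp (- E 0) * sqnorm_X m u0 - B 0"
proof -
  have "exp (- E t) * sqnorm_X m (U t) - B t \<le> exp (- E 0) * sqnorm_X m (U 0) - B 0"
  proof (rule gronwall_integrating_factor[OF t])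
    fix x assume x: "x \<in> {0..t}"
    show "((\<lambda>x. sqnorm_X m (U x)) has_real_derivative
        (\<Sum>j\<in>{- int m..int m}. 2 * Re (cnj (U x j) * field \<psi> b y x (U x) j))) (at x within {0..t})"
    proof (rule sqnorm_X_has_derivative)
      fix j assume "j \<in> {- int m..int m}"
      then have "((\<lambda>s. U s j) has_vector_derivative field \<psi> b y x (U x) j) (at x within {0..})"
        using sol x by (simp add: solves_def)
      then show "((\<lambda>s. U s j) has_vector_derivative field \<psi> b y x (U x) j) (at x within {0..t})"
        by (rule has_vector_derivative_within_subset) auto
    qed
    show "(\<Sum>j\<in>{- int m..int m}. 2 * Re (cnj (U x j) * field \<psi> b y x (U x) j))
        \<le> \<alpha> x * sqnorm_X m (U x) + (exp (- b * y x))\<^sup>2 / \<delta> * sqnorm_X m g"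
    proof -
      have "0 \<le> 2 * k * exp (p * b * y x) * (\<Sum>j\<in>{- int m..int m}. \<psi> x (cmod (U x j)) * (cmod (U x j))\<^sup>2)"
        using \<psi> k_pos by (intro mult_nonneg_nonneg sum_nonneg) auto
      then show ?thesis
        using dissipation[of "U x" \<psi> b y x] mult_right_mono[OF \<alpha>[OF x], of "sqnorm_X m (U x)"]
        by simp
    qed
  qed (use E B B' in auto)
  then show ?thesis using sol by (simp add: solves_def)
qed

lemma uniform_bound:
  assumes M: "M \<ge> 0" and Y: "Y \<ge> 0" and b: "\<bar>b\<bar> \<le> M" and t: "0 \<le> t" "t \<le> T"
    and y: "\<And>x. x \<in> {0..T} \<Longrightarrow> \<bar>y x\<bar> \<le> Y"
    and sol: "solves m (field \<psi> b y) u0 U" and \<psi>: "\<And>t r. \<psi> t r \<ge> 0"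
  shows "sqnorm_X m (U t) \<le> exp (2 * M * Y * T) * (sqnorm_X m u0 + exp (2 * M * Y) / \<delta> * sqnorm_X m g * T)"
proof -
  define c K where "c = 2 * M * Y" and "K = exp (2 * M * Y) / \<delta> * sqnorm_X m g"
  have "c \<ge> 0" "K \<ge> 0" using M Y \<delta>_pos by (auto simp: c_def K_def)
  have by_le: "\<bar>b * y x\<bar> \<le> M * Y" if "x \<in> {0..t}" for x
    using b y[of x] that t M by (auto simp: abs_mult intro!: mult_mono)
  have "exp (- (c * t)) * sqnorm_X m (U t) - K * t \<le> exp (- (c * 0)) * sqnorm_X m u0 - K * 0"
  proof (rule energy_growth[OF sol \<psi> t(1), of "\<lambda>x. c * x" "\<lambda>_. c" "\<lambda>x. K * x" "\<lambda>_. K"])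
    fix x assume x: "x \<in> {0..t}"
    show "- \<delta> + 2 * b * y x \<le> c" using by_le[OF x] \<delta>_pos by (simp add: c_def)
    have "(exp (- b * y x))\<^sup>2 = exp (- 2 * (b * y x))"
      by (simp add: power2_eq_square flip: exp_add)
    also have "\<dots> \<le> exp (2 * M * Y)" using by_le[OF x] by (simp add: abs_le_iff)
    finally have "(exp (- b * y x))\<^sup>2 / \<delta> * sqnorm_X m g \<le> K"
      unfolding K_def using \<delta>_pos by (intro mult_right_mono divide_right_mono) auto
    moreover have "exp (- (c * x)) \<le> 1" using \<open>c \<ge> 0\<close> x by simp
    ultimately show "exp (- (c * x)) * ((exp (- b * y x))\<^sup>2 / \<delta> * sqnorm_X m g) \<le> K"
      using mult_mono[of "exp (- (c * x))" 1 "(exp (- b * y x))\<^sup>2 / \<delta> * sqnorm_X m g" K] \<delta>_pos by simp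
  qed (auto intro!: derivative_eq_intros)
  then have "exp (- (c * t)) * sqnorm_X m (U t) \<le> sqnorm_X m u0 + K * t" by simp
  then have "exp (c * t) * (exp (- (c * t)) * sqnorm_X m (U t)) \<le> exp (c * t) * (sqnorm_X m u0 + K * t)"
    by (intro mult_left_mono) auto
  then have "sqnorm_X m (U t) \<le> exp (c * t) * (sqnorm_X m u0 + K * t)"
    by (simp add: mult.assoc[symmetric] flip: exp_add)
  also have "\<dots> \<le> exp (c * T) * (sqnorm_X m u0 + K * T)"
    using t \<open>c \<ge> 0\<close> \<open>K \<ge> 0\<close> by (intro mult_mono add_mono mult_left_mono) (auto intro!: mult_left_mono)
  finally show ?thesis by (simp add: c_def K_def)
qed

text \<open>The squared radius, up to a factor depending on the noise, of a ball that every solution has entered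
  after unit time.\<close>

definition absorbing_const :: real where
  "absorbing_const = (1 + 2 / p) powr (1 + 2 / p) * real (card {- int m..int m}) powr (1 + 2 / p) / (2 * k) powr (2 / p)
     + sqnorm_X m g / \<delta>"

lemma absorbing_const_nonneg: "absorbing_const \<ge> 0"
  using \<delta>_pos by (simp add: absorbing_const_def)

text \<open>Keeping the damping in the energy balance gives a differential inequality with exponent \<open>1 + p / 2\<close> for
  the squared norm. The coefficient of the damping is at least of order \<open>exp (- p M Y)\<close>, which after
  taking the power \<open>- 2 / p\<close> costs a factor \<open>exp (2 M Y)\<close>; another such factor bounds the powers of
  \<open>M Y\<close> that come from the linear growth rate.\<close>

lemma absorbed_in_unit_time:
  assumes sol: "solves m (field full b y) u0 U" and M: "M \<ge> 0" "\<bar>b\<bar> \<le> M"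
    and Y: "Y \<ge> 0" "\<And>x. x \<in> {0..1} \<Longrightarrow> \<bar>y x\<bar> \<le> Y"
  shows "sqnorm_X m (U 1) \<le> absorbing_const * exp (4 * M * Y)"
proof -
  let ?J = "{- int m..int m}"
  define N where "N = real (card ?J)"
  have N: "N > 0" by (simp add: N_def)
  define G where "G = exp (2 * M * Y) / \<delta> * sqnorm_X m g"
  define c where "c = 2 * k * exp (- (p * M * Y)) / N powr (1 + p / 2)"
  have c: "c > 0" using k_pos N by (simp add: c_def)
  have s: "1 + 1 / (p / 2) = 1 + 2 / p" by simp
  have "sqnorm_X m (U 1) \<le> (1 + 1 / (p / 2) + 2 * M * Y) powr (1 + 1 / (p / 2)) / c powr (1 / (p / 2)) + G"
  proof (rule superlinear_damping_forgets_initial_value[where \<phi> = "\<lambda>x. sqnorm_X m (U x)"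
        and \<phi>' = "\<lambda>x. \<Sum>j\<in>?J. 2 * Re (cnj (U x j) * field full b y x (U x) j)"])
    show "c > 0" "p / 2 > 0" "2 * M * Y \<ge> 0" "G \<ge> 0"
      using c p_pos M Y \<delta>_pos by (auto simp: G_def)
    show "sqnorm_X m (U x) \<ge> 0" for x by simp
    fix x :: real assume x: "x \<in> {0..1}"
    show "((\<lambda>x. sqnorm_X m (U x)) has_real_derivative
        (\<Sum>j\<in>?J. 2 * Re (cnj (U x j) * field full b y x (U x) j))) (at x within {0..1})"
    proof (rule sqnorm_X_has_derivative)
      fix j assume "j \<in> ?J"
      then have "((\<lambda>s. U s j) has_vector_derivative field full b y x (U x) j) (at x within {0..})"
        using sol x by (simp add: solves_def)
      then show "((\<lambda>s. U s j) has_vector_derivative field full b y x (U x) j) (at x within {0..1})"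
        by (rule has_vector_derivative_within_subset) auto
    qed
    have by_le: "\<bar>b * y x\<bar> \<le> M * Y"
      using M Y x by (auto simp: abs_mult intro!: mult_mono)
    have lin: "(- \<delta> + 2 * b * y x) * sqnorm_X m (U x) \<le> 2 * M * Y * sqnorm_X m (U x)"
      using by_le \<delta>_pos by (intro mult_right_mono) auto
    have frc: "(exp (- b * y x))\<^sup>2 / \<delta> * sqnorm_X m g \<le> G"
    proof -
      have "(exp (- b * y x))\<^sup>2 = exp (- 2 * (b * y x))"
        by (simp add: power2_eq_square flip: exp_add)
      also have "\<dots> \<le> exp (2 * M * Y)" using by_le by (simp add: abs_le_iff)
      finally show ?thesis
        unfolding G_def using \<delta>_pos by (intro mult_right_mono divide_right_mono) auto
    qed
    have damp: "c * sqnorm_X m (U x) powr (1 + p / 2)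
        \<le> 2 * k * exp (p * b * y x) * (\<Sum>j\<in>?J. cmod (U x j) powr p * (cmod (U x j))\<^sup>2)"
    proof -
      have "- (p * M * Y) \<le> p * b * y x"
        using mult_left_mono[of "- (M * Y)" "b * y x" p] by_le p_pos by (simp add: abs_le_iff mult.assoc)
      then have "2 * k * exp (- (p * M * Y)) * (sqnorm_X m (U x) / N) powr (1 + p / 2)
          \<le> 2 * k * exp (p * b * y x) * (\<Sum>j\<in>?J. cmod (U x j) powr p * (cmod (U x j))\<^sup>2)"
        using k_pos sum_powr_ge_sqnorm_X[OF p_pos, of m "U x"]
        by (intro mult_mono mult_left_mono) (auto simp: N_def)
      then show ?thesis using N by (simp add: c_def powr_divide)
    qed
    show "(\<Sum>j\<in>?J. 2 * Re (cnj (U x j) * field full b y x (U x) j))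
        \<le> 2 * M * Y * sqnorm_X m (U x) - c * sqnorm_X m (U x) powr (1 + p / 2) + G"
      using dissipation[of "U x" full b y x] lin frc damp by linarith
  qed
  also have "(1 + 1 / (p / 2) + 2 * M * Y) powr (1 + 1 / (p / 2)) / c powr (1 / (p / 2))
      \<le> (1 + 2 / p) powr (1 + 2 / p) * N powr (1 + 2 / p) / (2 * k) powr (2 / p) * exp (4 * M * Y)"
  proof -
    define s where "s = 1 + 2 / p"
    have "s > 0" using p_pos by (simp add: s_def add_pos_pos)
    have "s + 2 * M * Y = s * (1 + 2 * M * Y / s)" using \<open>s > 0\<close> by (simp add: distrib_left)
    then have "(s + 2 * M * Y) powr s = (s * (1 + 2 * M * Y / s)) powr s" by (rule arg_cong)
    also have "\<dots> = s powr s * (1 + 2 * M * Y / s) powr s"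
      by (rule powr_mult)
    also have "\<dots> \<le> s powr s * exp (2 * M * Y / s) powr s"
      using \<open>s > 0\<close> M Y by (intro mult_left_mono powr_mono2 exp_ge_add_one_self) auto
    also have "exp (2 * M * Y / s) powr s = exp (2 * M * Y)"
      using \<open>s > 0\<close> by (simp add: exp_powr_real)
    finally have 1: "(s + 2 * M * Y) powr s \<le> s powr s * exp (2 * M * Y)" .
    have "c powr (2 / p) = (2 * k) powr (2 / p) * exp (- (p * M * Y)) powr (2 / p) / (N powr (1 + p / 2)) powr (2 / p)"
      unfolding c_def using k_pos N by (simp add: powr_divide powr_mult)
    also have "exp (- (p * M * Y)) powr (2 / p) = exp (- (2 * M * Y))"
      using p_pos by (simp add: exp_powr_real)
    also have "(N powr (1 + p / 2)) powr (2 / p) = N powr s"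
    proof -
      have "(1 + p / 2) * (2 / p) = s" using p_pos by (simp add: s_def field_simps)
      then show ?thesis by (simp only: powr_powr)
    qed
    finally have 2: "c powr (2 / p) = (2 * k) powr (2 / p) * exp (- (2 * M * Y)) / N powr s" .
    have "(s + 2 * M * Y) powr s / c powr (2 / p) \<le> s powr s * exp (2 * M * Y) / c powr (2 / p)"
      by (rule divide_right_mono[OF 1]) simp
    also have "\<dots> = s powr s * N powr s / (2 * k) powr (2 / p) * (exp (2 * M * Y) * exp (2 * M * Y))"
      using N k_pos by (simp add: 2 exp_minus field_simps)
    also have "exp (2 * M * Y) * exp (2 * M * Y) = exp (4 * M * Y)"
      by (simp flip: exp_add)
    finally show ?thesis by (simp add: s_def)
  qed
  also have "G \<le> sqnorm_X m g / \<delta> * exp (4 * M * Y)"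
  proof -
    have "exp (2 * M * Y) \<le> exp (4 * M * Y)" using M Y by simp
    then have "sqnorm_X m g / \<delta> * exp (2 * M * Y) \<le> sqnorm_X m g / \<delta> * exp (4 * M * Y)"
      using \<delta>_pos by (intro mult_left_mono) auto
    then show ?thesis by (simp add: G_def mult.commute)
  qed
  finally show ?thesis by (simp add: absorbing_const_def N_def algebra_simps)
qed

section \<open>Existence, uniqueness and dependence on the parameter\<close>

definition lipschitz_const :: "real \<Rightarrow> real \<Rightarrow> real \<Rightarrow> real" where
  "lipschitz_const M Y R = 4 * cmod (Complex lam \<mu>) + cmod (Complex \<gamma> \<beta>)
     + cmod (Complex k \<nu>) * exp (p * M * Y) * ((1 + p) * R powr p) + M * Y"

lemma cut_field_lipschitz:
  assumes j: "j \<in> {- int m..int m}" and y: "\<bar>y t\<bar> \<le> Y" and b: "\<bar>b\<bar> \<le> M" and R: "0 \<le> R t" "R t \<le> Rmax"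
  shows "cmod (field (cut R) b y t u j - field (cut R) b y t v j)
    \<le> lipschitz_const M Y Rmax * (\<Sum>i\<in>{- int m..int m}. cmod (u i - v i))"
proof -
  define S where "S = (\<Sum>i\<in>{- int m..int m}. cmod (u i - v i))"
  have S: "cmod (u i - v i) \<le> S" if "i \<in> {- int m..int m}" for i
    unfolding S_def using that by (intro member_le_sum[of i _ "\<lambda>i. cmod (u i - v i)"]) auto
  have "S \<ge> 0" by (simp add: S_def sum_nonneg)
  have MY: "\<bar>b * y t\<bar> \<le> M * Y"
    using b y by (auto simp: abs_mult intro!: mult_mono)
  define h where "h = (\<lambda>w. complex_of_real (min (cmod w) (R t) powr p) * w)"
  have "cmod (Lap m u j - Lap m v j) \<le> 4 * S"
  proof -
    have "Lap m u j - Lap m v j = 2 * (u j - v j) - (u (cyclic_pred m j) - v (cyclic_pred m j)) - (u (cyclic_succ m j) - v (cyclic_succ m j))"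
      by (simp add: Lap_eq)
    also have "cmod \<dots> \<le> cmod (2 * (u j - v j)) + cmod (u (cyclic_pred m j) - v (cyclic_pred m j)) + cmod (u (cyclic_succ m j) - v (cyclic_succ m j))"
      using norm_sub_sub_add_le[of "2 * (u j - v j)" "u (cyclic_pred m j) - v (cyclic_pred m j)" "u (cyclic_succ m j) - v (cyclic_succ m j)" 0]
      by (simp only: add_0_right norm_zero)
    also have "\<dots> \<le> 2 * S + S + S"
      using S by (intro add_mono cyclic_pred_in cyclic_succ_in j) (auto simp only: norm_mult norm_numeral intro!: mult_left_mono j cyclic_pred_in cyclic_succ_in)
    finally show ?thesis by simp
  qed
  then have t1: "cmod (Complex lam \<mu> * (Lap m u j - Lap m v j)) \<le> cmod (Complex lam \<mu>) * (4 * S)"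
    unfolding norm_mult by (rule mult_left_mono) simp
  have t2: "cmod (Complex \<gamma> \<beta> * (u j - v j)) \<le> cmod (Complex \<gamma> \<beta>) * S"
    unfolding norm_mult by (rule mult_left_mono[OF S[OF j]]) simp
  have t3: "cmod (Complex k \<nu> * complex_of_real (exp (p * b * y t)) * (h (u j) - h (v j)))
      \<le> cmod (Complex k \<nu>) * exp (p * M * Y) * ((1 + p) * Rmax powr p * S)"
  proof -
    have "cmod (h (u j) - h (v j)) \<le> (1 + p) * R t powr p * cmod (u j - v j)"
      unfolding h_def by (rule min_powr_lipschitz[OF p_pos R(1)])
    also have "\<dots> \<le> (1 + p) * Rmax powr p * S"
      using p_pos R S[OF j] by (intro mult_mono mult_left_mono powr_mono2) auto
    finally have "cmod (h (u j) - h (v j)) \<le> (1 + p) * Rmax powr p * S" .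
    moreover have "p * b * y t \<le> p * M * Y"
      using MY p_pos by (simp add: mult.assoc abs_le_iff)
    ultimately show ?thesis
      unfolding norm_mult by (intro mult_mono mult_left_mono) auto
  qed
  have t4: "cmod (complex_of_real (b * y t) * (u j - v j)) \<le> M * Y * S"
    unfolding norm_mult using MY S[OF j] by (intro mult_mono) (auto simp del: of_real_mult)
  have "field (cut R) b y t u j - field (cut R) b y t v j =
      Complex lam \<mu> * (Lap m u j - Lap m v j) - Complex \<gamma> \<beta> * (u j - v j)
      - Complex k \<nu> * complex_of_real (exp (p * b * y t)) * (h (u j) - h (v j))
      + complex_of_real (b * y t) * (u j - v j)"
    by (simp add: field_def h_def algebra_simps)
  also have "cmod \<dots> \<le> cmod (Complex lam \<mu> * (Lap m u j - Lap m v j)) + cmod (Complex \<gamma> \<beta> * (u j - v j))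
      + cmod (Complex k \<nu> * complex_of_real (exp (p * b * y t)) * (h (u j) - h (v j)))
      + cmod (complex_of_real (b * y t) * (u j - v j))"
    by (rule norm_sub_sub_add_le)
  also have "\<dots> \<le> lipschitz_const M Y Rmax * S"
    using t1 t2 t3 t4 by (simp add: lipschitz_const_def algebra_simps)
  finally show ?thesis by (simp add: S_def)
qed

definition param_lipschitz_const :: "real \<Rightarrow> real \<Rightarrow> real \<Rightarrow> real" where
  "param_lipschitz_const M Y R = cmod (Complex k \<nu>) * (exp (p * M * Y) * (p * Y)) * (R powr p * R)
     + exp (M * Y) * Y * sqrt (sqnorm_X m g) + Y * R"

lemma cut_field_parameter_lipschitz:
  assumes j: "j \<in> {- int m..int m}" and y: "\<bar>y t\<bar> \<le> Y" and b: "\<bar>b\<bar> \<le> M" "\<bar>b'\<bar> \<le> M"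
    and R: "cmod (u j) \<le> R"
  shows "cmod (field (cut (\<lambda>_. R)) b y t u j - field (cut (\<lambda>_. R)) b' y t u j) \<le> param_lipschitz_const M Y R * \<bar>b - b'\<bar>"
proof -
  have "Y \<ge> 0" "R \<ge> 0" "M \<ge> 0" using y R b by (auto intro: order_trans[OF norm_ge_zero] order_trans[OF abs_ge_zero])
  define h where "h = complex_of_real (min (cmod (u j)) R powr p) * u j"
  have MY: "\<bar>b * y t\<bar> \<le> M * Y" "\<bar>b' * y t\<bar> \<le> M * Y"
    using b y \<open>M \<ge> 0\<close> by (auto simp: abs_mult intro!: mult_mono)
  have "\<bar>b * y t - b' * y t\<bar> = \<bar>b - b'\<bar> * \<bar>y t\<bar>"
    by (simp add: left_diff_distrib flip: abs_mult)
  then have d: "\<bar>b * y t - b' * y t\<bar> \<le> Y * \<bar>b - b'\<bar>"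
    using y by (metis abs_ge_zero mult.commute mult_left_mono)
  have e1: "\<bar>exp (p * b * y t) - exp (p * b' * y t)\<bar> \<le> exp (p * M * Y) * (p * Y) * \<bar>b - b'\<bar>"
  proof -
    have "\<bar>exp (p * b * y t) - exp (p * b' * y t)\<bar> \<le> exp (p * M * Y) * \<bar>p * b * y t - p * b' * y t\<bar>"
      using MY p_pos by (intro abs_exp_diff_le) (auto simp: mult.assoc abs_le_iff)
    also have "\<bar>p * b * y t - p * b' * y t\<bar> = p * \<bar>b * y t - b' * y t\<bar>"
      using p_pos by (simp add: mult.assoc abs_mult flip: right_diff_distrib)
    also have "\<dots> \<le> p * (Y * \<bar>b - b'\<bar>)" using d p_pos by (intro mult_left_mono) auto
    finally show ?thesis by (simp add: mult_ac)
  qed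
  have e2: "\<bar>exp (- b * y t) - exp (- b' * y t)\<bar> \<le> exp (M * Y) * Y * \<bar>b - b'\<bar>"
  proof -
    have "\<bar>exp (- b * y t) - exp (- b' * y t)\<bar> \<le> exp (M * Y) * \<bar>- b * y t - (- b' * y t)\<bar>"
      using MY by (intro abs_exp_diff_le) (auto simp: abs_le_iff)
    also have "\<bar>- b * y t - (- b' * y t)\<bar> = \<bar>b * y t - b' * y t\<bar>" by simp
    also have "exp (M * Y) * \<dots> \<le> exp (M * Y) * (Y * \<bar>b - b'\<bar>)" using d by (intro mult_left_mono) auto
    finally show ?thesis by (simp add: mult_ac)
  qed
  have h: "cmod h \<le> R powr p * R"
    unfolding h_def norm_mult using R p_pos \<open>R \<ge> 0\<close> by (intro mult_mono) (auto intro!: powr_mono2)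
  have t1: "cmod (Complex k \<nu> * complex_of_real (exp (p * b * y t) - exp (p * b' * y t)) * h)
      \<le> cmod (Complex k \<nu>) * (exp (p * M * Y) * (p * Y) * \<bar>b - b'\<bar>) * (R powr p * R)"
    unfolding norm_mult norm_of_real using e1 h p_pos \<open>Y \<ge> 0\<close>
    by (intro mult_mono mult_left_mono) auto
  have t2: "cmod (complex_of_real (exp (- b * y t) - exp (- b' * y t)) * g j)
      \<le> exp (M * Y) * Y * \<bar>b - b'\<bar> * sqrt (sqnorm_X m g)"
    unfolding norm_mult norm_of_real using e2 \<open>Y \<ge> 0\<close> cmod_le_sqrt_sqnorm_X[OF j] by (intro mult_mono) auto
  have t3: "cmod (complex_of_real (b * y t - b' * y t) * u j) \<le> Y * \<bar>b - b'\<bar> * R"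
    unfolding norm_mult norm_of_real using d R \<open>Y \<ge> 0\<close> by (intro mult_mono) auto
  have "field (cut (\<lambda>_. R)) b y t u j - field (cut (\<lambda>_. R)) b' y t u j =
      0 - Complex k \<nu> * complex_of_real (exp (p * b * y t) - exp (p * b' * y t)) * h
      - (- (complex_of_real (exp (- b * y t) - exp (- b' * y t)) * g j))
      + complex_of_real (b * y t - b' * y t) * u j"
    by (simp add: field_def h_def algebra_simps)
  also have "cmod \<dots> \<le> cmod (Complex k \<nu> * complex_of_real (exp (p * b * y t) - exp (p * b' * y t)) * h)
      + cmod (complex_of_real (exp (- b * y t) - exp (- b' * y t)) * g j)
      + cmod (complex_of_real (b * y t - b' * y t) * u j)"
    by (rule order_trans[OF norm_sub_sub_add_le]) (simp only: norm_minus_cancel norm_zero add_0_left order_refl)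
  also have "\<dots> \<le> param_lipschitz_const M Y R * \<bar>b - b'\<bar>"
    using t1 t2 t3 by (simp add: param_lipschitz_const_def algebra_simps)
  finally show ?thesis .
qed

text \<open>Solutions with equally bounded initial values and parameters stay in a common ball, so there the
  nonlinearity may be replaced by a cut-off at a constant level, and the difference of two solutions obeys a linear
  differential inequality. The constant \<open>K\<close> is uniform over initial values of bounded norm; the case
  \<open>b = b'\<close> is uniqueness.\<close>

lemma solution_stability:
  assumes y: "continuous_on {0..} y" and M: "M \<ge> 0"
  obtains K where "\<And>b b' u0 U V t. \<bar>b\<bar> \<le> M \<Longrightarrow> \<bar>b'\<bar> \<le> M \<Longrightarrow> sqnorm_X m u0 \<le> r \<Longrightarrow>
    solves m (field full b y) u0 U \<Longrightarrow> solves m (field full b' y) u0 V \<Longrightarrow> t \<in> {0..T} \<Longrightarrow>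
    sqnorm_X m (\<lambda>j. U t j - V t j) \<le> K * (b - b')\<^sup>2"
proof -
  let ?J = "{- int m..int m}"
  obtain Y where Y: "Y \<ge> 0" "\<And>t. t \<in> {0..T} \<Longrightarrow> \<bar>y t\<bar> \<le> Y"
    using bounded_on_compact_interval[of 0 T y] continuous_on_subset[OF y, of "{0..T}"] by auto
  define R where "R = sqrt (exp (2 * M * Y * T) * (r + exp (2 * M * Y) / \<delta> * sqnorm_X m g * T))"
  define L K N where "L = lipschitz_const M Y R" and "K = param_lipschitz_const M Y R" and "N = real (card ?J)"
  define c where "c = (2 * L + 1) * N"
  show ?thesis
  proof (rule that[of "exp (c * T) * (K\<^sup>2 * T)"])
    fix b b' u0 U V t
    assume b: "\<bar>b\<bar> \<le> M" "\<bar>b'\<bar> \<le> M" and u0: "sqnorm_X m u0 \<le> r"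
      and U: "solves m (field full b y) u0 U" and V: "solves m (field full b' y) u0 V"
      and t: "t \<in> {0..T}"
    have T: "T \<ge> 0" using t by simp
    have small: "cmod (W x j) \<le> R"
      if "x \<in> {0..T}" "j \<in> ?J" "\<bar>d\<bar> \<le> M" "solves m (field full d y) u0 W" for W d x j
    proof -
      have "sqnorm_X m (W x) \<le> exp (2 * M * Y * T) * (sqnorm_X m u0 + exp (2 * M * Y) / \<delta> * sqnorm_X m g * T)"
        using that Y by (intro uniform_bound[OF M Y(1) that(3) _ _ _ that(4)]) auto
      also have "\<dots> \<le> exp (2 * M * Y * T) * (r + exp (2 * M * Y) / \<delta> * sqnorm_X m g * T)"
        using u0 by (intro mult_left_mono) auto
      finally show ?thesis
        using cmod_le_sqrt_sqnorm_X[OF that(2), of "W x"] unfolding R_def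
        by (meson order_trans real_sqrt_le_mono)
    qed
    have "R \<ge> 0" using order_trans[OF norm_ge_zero small[OF t _ b(1) U, of 0]] by simp
    have "L \<ge> 0" unfolding L_def lipschitz_const_def using M Y p_pos by (intro add_nonneg_nonneg mult_nonneg_nonneg) auto
    have "K \<ge> 0" unfolding K_def param_lipschitz_const_def using M Y p_pos \<open>R \<ge> 0\<close>
      by (intro add_nonneg_nonneg mult_nonneg_nonneg) auto
    have "c \<ge> 0" using \<open>L \<ge> 0\<close> by (simp add: c_def N_def)
    define D where "D = (\<lambda>x j. U x j - V x j)"
    define F where "F = (\<lambda>x j. field full b y x (U x) j - field full b' y x (V x) j)"
    have tend: "exp (- (c * t)) * sqnorm_X m (D t) - K\<^sup>2 * (b - b')\<^sup>2 * t
        \<le> exp (- (c * 0)) * sqnorm_X m (D 0) - K\<^sup>2 * (b - b')\<^sup>2 * 0"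
    proof (rule gronwall_integrating_factor[where s = 0 and t = t and E = "\<lambda>x. c * x"
          and B = "\<lambda>x. K\<^sup>2 * (b - b')\<^sup>2 * x" and \<phi> = "\<lambda>x. sqnorm_X m (D x)" and \<alpha> = "\<lambda>_. c" and \<beta> = "\<lambda>_. K\<^sup>2 * (b - b')\<^sup>2"
          and B' = "\<lambda>_. K\<^sup>2 * (b - b')\<^sup>2" and \<phi>' = "\<lambda>x. \<Sum>j\<in>?J. 2 * Re (cnj (D x j) * F x j)"])
      fix x assume x: "x \<in> {0..t}"
      then have xT: "x \<in> {0..T}" using t by simp
      show "((\<lambda>x. sqnorm_X m (D x)) has_real_derivative (\<Sum>j\<in>?J. 2 * Re (cnj (D x j) * F x j))) (at x within {0..t})"
      proof (rule sqnorm_X_has_derivative)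
        fix j assume "j \<in> ?J"
        then have "((\<lambda>s. D s j) has_vector_derivative F x j) (at x within {0..})"
          using U V x unfolding D_def F_def by (intro has_vector_derivative_diff) (auto simp: solves_def)
        then show "((\<lambda>s. D s j) has_vector_derivative F x j) (at x within {0..t})"
          by (rule has_vector_derivative_within_subset) auto
      qed
      define S where "S = (\<Sum>j\<in>?J. cmod (D x j))"
      have "S \<ge> 0" by (simp add: S_def sum_nonneg)
      have F: "cmod (F x j) \<le> L * S + K * \<bar>b - b'\<bar>" if j: "j \<in> ?J" for j
      proof -
        let ?f = "field (cut (\<lambda>_. R))"
        have "F x j = (?f b y x (U x) j - ?f b y x (V x) j) + (?f b y x (V x) j - ?f b' y x (V x) j)"
          using small[OF xT j b(1) U] small[OF xT j b(2) V] by (simp add: F_def field_cut_eq_full)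
        moreover have "cmod (?f b y x (U x) j - ?f b y x (V x) j) \<le> L * S"
          unfolding L_def S_def D_def
          using cut_field_lipschitz[where R = "\<lambda>_. R" and Rmax = R and y = y and t = x and Y = Y and b = b
              and M = M and j = j] j Y(2)[OF xT] b(1) \<open>R \<ge> 0\<close> by simp
        moreover have "cmod (?f b y x (V x) j - ?f b' y x (V x) j) \<le> K * \<bar>b - b'\<bar>"
          unfolding K_def
          using cut_field_parameter_lipschitz[where R = R and y = y and t = x and Y = Y and b = b and b' = b'
              and M = M and j = j] j Y(2)[OF xT] b small[OF xT j b(2) V] by simp
        ultimately show ?thesis using norm_triangle_mono by metis
      qed
      have "(\<Sum>j\<in>?J. 2 * Re (cnj (D x j) * F x j)) \<le> (\<Sum>j\<in>?J. 2 * (L * S + K * \<bar>b - b'\<bar>) * cmod (D x j))"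
      proof (rule sum_mono)
        fix j assume "j \<in> ?J"
        have "Re (cnj (D x j) * F x j) \<le> cmod (D x j) * cmod (F x j)"
          using complex_Re_le_cmod[of "cnj (D x j) * F x j"] by (simp add: norm_mult)
        also have "\<dots> \<le> cmod (D x j) * (L * S + K * \<bar>b - b'\<bar>)"
          by (rule mult_left_mono[OF F[OF \<open>j \<in> ?J\<close>]]) simp
        finally have "2 * Re (cnj (D x j) * F x j) \<le> 2 * (cmod (D x j) * (L * S + K * \<bar>b - b'\<bar>))"
          by (rule mult_left_mono) simp
        then show "2 * Re (cnj (D x j) * F x j) \<le> 2 * (L * S + K * \<bar>b - b'\<bar>) * cmod (D x j)"
          by (simp only: mult_ac)
      qed
      also have "\<dots> = 2 * (L * S + K * \<bar>b - b'\<bar>) * S"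
        by (simp only: S_def sum_distrib_left)
      \<comment> \<open>Young's inequality turns the parameter difference into a quadratic forcing term.\<close>
      also have "\<dots> \<le> (2 * L + 1) * S\<^sup>2 + K\<^sup>2 * (b - b')\<^sup>2"
        using sum_squares_bound[of S "K * \<bar>b - b'\<bar>"] by (simp add: power_mult_distrib algebra_simps power2_eq_square)
      also have "S\<^sup>2 \<le> N * sqnorm_X m (D x)"
        using sum_squared_le_sum_of_squares[of "\<lambda>j. cmod (D x j)" ?J]
        by (simp add: S_def N_def sqnorm_X_def mult.commute)
      then have "(2 * L + 1) * S\<^sup>2 + K\<^sup>2 * (b - b')\<^sup>2 \<le> c * sqnorm_X m (D x) + K\<^sup>2 * (b - b')\<^sup>2"
        using \<open>L \<ge> 0\<close> mult_left_mono[of "S\<^sup>2" "N * sqnorm_X m (D x)" "2 * L + 1"] by (simp add: c_def mult.assoc)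
      finally show "(\<Sum>j\<in>?J. 2 * Re (cnj (D x j) * F x j)) \<le> c * sqnorm_X m (D x) + K\<^sup>2 * (b - b')\<^sup>2" .
      have "exp (- (c * x)) \<le> 1" using \<open>c \<ge> 0\<close> x by simp
      then show "exp (- (c * x)) * (K\<^sup>2 * (b - b')\<^sup>2) \<le> K\<^sup>2 * (b - b')\<^sup>2"
        by (rule mult_left_le_one_le[rotated 2]) auto
    qed (use t in \<open>auto intro!: derivative_eq_intros\<close>)
    moreover have "sqnorm_X m (D 0) = 0"
      using U V by (simp add: D_def solves_def sqnorm_X_def)
    ultimately have "exp (- (c * t)) * sqnorm_X m (D t) \<le> K\<^sup>2 * (b - b')\<^sup>2 * t" by simp
    then have "exp (c * t) * (exp (- (c * t)) * sqnorm_X m (D t)) \<le> exp (c * t) * (K\<^sup>2 * (b - b')\<^sup>2 * t)"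
      by (intro mult_left_mono) auto
    then have "sqnorm_X m (D t) \<le> exp (c * t) * (K\<^sup>2 * (b - b')\<^sup>2 * t)"
      by (simp add: mult.assoc[symmetric] flip: exp_add)
    also have "\<dots> \<le> exp (c * T) * (K\<^sup>2 * (b - b')\<^sup>2 * T)"
      using t \<open>c \<ge> 0\<close> by (intro mult_mono mult_left_mono) (auto intro!: mult_left_mono)
    finally show "sqnorm_X m (\<lambda>j. U t j - V t j) \<le> exp (c * T) * (K\<^sup>2 * T) * (b - b')\<^sup>2"
      by (simp add: D_def mult_ac)
  qed
qed

lemma solution_unique:
  assumes y: "continuous_on {0..} y" and U: "solves m (field full b y) u0 U"
    and V: "solves m (field full b y) u0 V" and t: "t \<ge> 0"
  shows "U t = V t"
proof -
  have "\<exists>K. sqnorm_X m (\<lambda>j. U t j - V t j) \<le> K * (b - b)\<^sup>2"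
    by (rule solution_stability[OF y abs_ge_zero[of b], of "sqnorm_X m u0" t]) (use U V t in fastforce)
  then obtain K where "sqnorm_X m (\<lambda>j. U t j - V t j) \<le> K * (b - b)\<^sup>2" by blast
  then have "sqnorm_X m (\<lambda>j. U t j - V t j) = 0"
    using sqnorm_X_nonneg[of m "\<lambda>j. U t j - V t j"] by (simp add: order_antisym)
  then have "\<forall>j\<in>{- int m..int m}. U t j = V t j"
    unfolding sqnorm_X_def by (subst (asm) sum_nonneg_eq_0_iff) auto
  then show ?thesis using U V t by (intro eq_on_X[of _ m]) (auto simp: solves_def)
qed

text \<open>The cut-off level \<open>R t\<close> is the a priori bound that the energy estimate gives for solutions of any of the
  cut equations. Letting it depend on \<open>t\<close> yields a solution on the whole half-line at once, without
  gluing solutions on bounded intervals.\<close>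

lemma solution_exists:
  assumes y: "continuous_on UNIV y" and u0: "u0 \<in> X m"
  obtains U where "solves m (field full b y) u0 U"
proof -
  let ?J = "{- int m..int m}"
  have "continuous_on UNIV (\<lambda>x. - \<delta> + 2 * b * y x)" by (intro continuous_intros y)
  then obtain E where E: "\<And>x. (E has_real_derivative (- \<delta> + 2 * b * y x)) (at x)" "E 0 = 0"
    using continuous_real_antiderivative by metis
  have Ec: "continuous_on UNIV E"
    using E(1) by (meson DERIV_isCont continuous_at_imp_continuous_on)
  define B' where "B' = (\<lambda>x. exp (- E x) * ((exp (- b * y x))\<^sup>2 / \<delta> * sqnorm_X m g))"
  have "continuous_on UNIV B'"
    unfolding B'_def using \<delta>_pos by (intro continuous_intros y Ec) auto
  then obtain B where B: "\<And>x. (B has_real_derivative B' x) (at x)" "B 0 = 0"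
    using continuous_real_antiderivative by metis
  have Bc: "continuous_on UNIV B"
    using B(1) by (meson DERIV_isCont continuous_at_imp_continuous_on)
  \<comment> \<open>The absolute value keeps the radicand nonnegative for negative times.\<close>
  define R where "R = (\<lambda>t. sqrt (exp (E t) * (sqnorm_X m u0 + \<bar>B t\<bar>)))"
  have Rc: "continuous_on UNIV R"
    unfolding R_def by (intro continuous_intros Ec Bc)
  have R0: "R t \<ge> 0" for t by (simp add: R_def)
  obtain U where U: "U 0 = u0"
    "\<And>t j. t \<ge> 0 \<Longrightarrow> j \<in> ?J \<Longrightarrow>
      ((\<lambda>s. U s j) has_vector_derivative field (cut R) b y t (U t) j) (at t within {0..})"
    "\<And>t j. j \<notin> ?J \<Longrightarrow> U t j = u0 j"
  proof (rule picard_lindelof_global[of ?J "field (cut R) b y" u0])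
    fix u :: "real \<Rightarrow> int \<Rightarrow> complex" and j
    assume j: "j \<in> ?J" and u: "\<And>i. i \<in> ?J \<Longrightarrow> continuous_on {0..} (\<lambda>t. u t i)"
    have yc: "continuous_on {0..} y" and Rc': "continuous_on {0..} R"
      using y Rc by (auto intro: continuous_on_subset)
    have lap: "continuous_on {0..} (\<lambda>t. Lap m (u t) j)"
      unfolding Lap_eq
      by (intro continuous_on_diff continuous_on_mult continuous_on_const u cyclic_succ_in cyclic_pred_in j)
    have w: "continuous_on {0..} (\<lambda>t. min (cmod (u t j)) (R t) powr p)"
      by (intro continuous_on_powr' continuous_intros u[OF j] Rc') (use R0 p_pos in auto)
    show "continuous_on {0..} (\<lambda>t. field (cut R) b y t (u t) j)"
      unfolding field_def
      by (intro continuous_on_add continuous_on_diff continuous_on_mult continuous_on_const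
          continuous_on_of_real continuous_on_exp lap w yc u[OF j])
  next
    fix T
    obtain Y where Y: "Y \<ge> 0" "\<And>t. t \<in> {0..T} \<Longrightarrow> \<bar>y t\<bar> \<le> Y"
      using bounded_on_compact_interval[of 0 T y] continuous_on_subset[OF y, of "{0..T}"] by auto
    obtain R1 where R1: "R1 \<ge> 0" "\<And>t. t \<in> {0..T} \<Longrightarrow> \<bar>R t\<bar> \<le> R1"
      using bounded_on_compact_interval[of 0 T R] continuous_on_subset[OF Rc, of "{0..T}"] by auto
    show "\<exists>L. \<forall>t\<in>{0..T}. \<forall>u v. \<forall>j\<in>?J.
        norm (field (cut R) b y t u j - field (cut R) b y t v j) \<le> L * (\<Sum>i\<in>?J. norm (u i - v i))"
      using Y(2) R1(2) R0
      by (intro exI[of _ "lipschitz_const \<bar>b\<bar> Y R1"] ballI allI cut_field_lipschitz) (auto simp: abs_le_iff)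
  qed auto
  have "U t j = 0" if "\<bar>j\<bar> > int m" for t j
  proof -
    have "j \<notin> ?J" using that by auto
    then show ?thesis using that u0 U(3) by (simp add: X_def)
  qed
  then have Ucut: "solves m (field (cut R) b y) u0 U"
    using U(1,2) by (simp add: solves_def X_def)
  have UR: "cmod (U t j) \<le> R t" if "t \<ge> 0" "j \<in> ?J" for t j
  proof -
    have "exp (- E t) * sqnorm_X m (U t) - B t \<le> exp (- E 0) * sqnorm_X m u0 - B 0"
    proof (rule energy_growth[OF Ucut _ that(1)])
      show "(E has_real_derivative - \<delta> + 2 * b * y x) (at x within {0..t})" for x
        by (rule has_field_derivative_at_within[OF E(1)])
      show "(B has_real_derivative B' x) (at x within {0..t})" for x
        by (rule has_field_derivative_at_within[OF B(1)])
    qed (simp_all add: B'_def)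
    then have "exp (- E t) * sqnorm_X m (U t) \<le> sqnorm_X m u0 + \<bar>B t\<bar>"
      using E(2) B(2) by simp
    then have "exp (E t) * (exp (- E t) * sqnorm_X m (U t)) \<le> exp (E t) * (sqnorm_X m u0 + \<bar>B t\<bar>)"
      by (intro mult_left_mono) auto
    then have "sqnorm_X m (U t) \<le> exp (E t) * (sqnorm_X m u0 + \<bar>B t\<bar>)"
      by (simp add: mult.assoc[symmetric] flip: exp_add)
    then show ?thesis
      using cmod_le_sqrt_sqnorm_X[OF that(2), of "U t"] unfolding R_def
      by (meson order_trans real_sqrt_le_mono)
  qed
  have "solves m (field full b y) u0 U"
    using Ucut UR by (auto simp: solves_def field_cut_eq_full)
  then show ?thesis by (rule that)
qed

abbreviation flow :: "real \<Rightarrow> real \<Rightarrow> (real \<Rightarrow> real) \<Rightarrow> (int \<Rightarrow> complex) \<Rightarrow> int \<Rightarrow> complex" where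
  "flow \<equiv> Xi lam \<mu> \<gamma> \<beta> k \<nu> p g m"

abbreviation noise :: "(real \<Rightarrow> real) \<Rightarrow> real \<Rightarrow> real" where
  "noise \<omega> \<equiv> \<lambda>t. OU (shift t \<omega>)"

lemma flow_eq_solution:
  assumes "continuous_on UNIV (noise \<omega>)" "u0 \<in> X m"
  obtains U where "solves m (field full b (noise \<omega>)) u0 U" "\<And>t. t \<ge> 0 \<Longrightarrow> flow b t \<omega> u0 = U t"
proof -
  obtain U where U: "solves m (field full b (noise \<omega>)) u0 U"
    using solution_exists[OF assms] by blast
  have y: "continuous_on {0..} (noise \<omega>)" using assms(1) by (rule continuous_on_subset) auto
  have "flow b t \<omega> u0 = U t" if t: "t \<ge> 0" for t
    unfolding Xi_def rhs_eq_field
  proof (rule the_equality)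
    show "\<exists>V. solves m (field full b (noise \<omega>)) u0 V \<and> U t = V t" using U by blast
    fix x assume "\<exists>V. solves m (field full b (noise \<omega>)) u0 V \<and> x = V t"
    then show "x = U t" using solution_unique[OF y _ U t] by blast
  qed
  with U show ?thesis by (rule that)
qed

end

section \<open>Attractors bounded uniformly in the parameter\<close>

lemma shift_shift: "shift s (shift t \<omega>) = shift (t + s) \<omega>"
  by (simp add: shift_def fun_eq_iff add.assoc)

lemma admissible_shift: "admissible_paths P \<Omega> \<Longrightarrow> \<omega> \<in> \<Omega> \<Longrightarrow> shift t \<omega> \<in> \<Omega>"
  unfolding admissible_paths_def by blast

text \<open>Paths in the range of any shift vanish at 0, so the identity follows from the invariance of \<open>\<Omega>\<close>.\<close>

lemma admissible_shift_0:
  assumes "admissible_paths P \<Omega>" "\<omega> \<in> \<Omega>" shows "shift 0 \<omega> = \<omega>"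
proof -
  have "\<omega> \<in> shift 0 ` \<Omega>" using assms unfolding admissible_paths_def by blast
  then show ?thesis by (auto simp: shift_shift)
qed

lemma random_attractor_subset_X:
  assumes "random_attractor m P \<Omega> \<Phi> A" "\<omega> \<in> \<Omega>" shows "A \<omega> \<subseteq> X m"
  using assms compactin_subset_topspace unfolding random_attractor_def
  by (metis Metric_space.topspace_mtopology[OF Metric_space_X])

context truncated_lattice
begin

text \<open>A point of the attractor at noise \<open>\<theta>\<^sub>-\<^sub>\<tau> \<omega>\<close> is the value at time 1 of a solution started at noise
  \<open>\<theta>\<^sub>-\<^sub>\<tau>\<^sub>-\<^sub>1 \<omega>\<close>. The slope \<open>\<eta>\<close> of the sublinear bound on the noise is chosen so that the
  factor \<open>exp (4 M Y)\<close> of the unit time estimate grows at rate \<open>\<rho>\<close>.\<close>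

lemma attractors_uniformly_tempered:
  assumes adm: "admissible_paths P \<Omega>" and \<omega>: "\<omega> \<in> \<Omega>"
    and att: "\<And>i. random_attractor m P \<Omega> (flow (b i)) (A i)"
    and b: "\<And>i. \<bar>b i\<bar> \<le> M" and \<rho>: "\<rho> > 0"
  obtains C where "C \<ge> 0"
    "\<And>i \<tau> u. \<tau> \<ge> 0 \<Longrightarrow> u \<in> A i (shift (- \<tau>) \<omega>) \<Longrightarrow> sqnorm_X m u \<le> C * exp (\<rho> * \<tau>)"
proof -
  \<comment> \<open>A positive bound, as it occurs in a denominator.\<close>
  define M' where "M' = max M 1"
  have M': "M' > 0" "\<bar>b i\<bar> \<le> M'" for i using b[of i] by (auto simp: M'_def)
  define \<eta> where "\<eta> = \<rho> / (4 * M')"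
  have \<eta>: "\<eta> > 0" "4 * M' * \<eta> = \<rho>" using M'(1) \<rho> by (auto simp: \<eta>_def)
  obtain C where C: "C \<ge> 0" "\<And>r. r \<le> 0 \<Longrightarrow> \<bar>noise \<omega> r\<bar> \<le> C + \<eta> * \<bar>r\<bar>"
  proof (rule sublinear_bound_at_bot[of "noise \<omega>" \<eta>])
    show "continuous_on UNIV (noise \<omega>)" "((\<lambda>t. \<bar>noise \<omega> t\<bar> / \<bar>t\<bar>) \<longlongrightarrow> 0) at_bot"
      using adm \<omega> unfolding admissible_paths_def by blast+
  qed (rule \<eta>(1), rule that)
  show ?thesis
  proof (rule that[of "absorbing_const * exp (4 * M' * C + \<rho>)"])
    fix i \<tau> u assume \<tau>: "\<tau> \<ge> 0" and u: "u \<in> A i (shift (- \<tau>) \<omega>)"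
    let ?\<omega> = "shift (- \<tau> - 1) \<omega>"
    have \<omega>': "?\<omega> \<in> \<Omega>" by (rule admissible_shift[OF adm \<omega>])
    have "flow (b i) 1 ?\<omega> ` A i ?\<omega> = A i (shift 1 ?\<omega>)"
      using att[of i] \<omega>' by (simp add: random_attractor_def)
    then have "u \<in> flow (b i) 1 ?\<omega> ` A i ?\<omega>" using u by (simp add: shift_shift)
    then obtain u0 where u0: "u0 \<in> A i ?\<omega>" "u = flow (b i) 1 ?\<omega> u0" by blast
    have cont: "continuous_on UNIV (noise ?\<omega>)" using adm \<omega>' by (simp add: admissible_paths_def)
    have u0X: "u0 \<in> X m" using random_attractor_subset_X[OF att \<omega>'] u0(1) by blast
    obtain U where U: "solves m (field full (b i) (noise ?\<omega>)) u0 U" "u = U 1"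
      unfolding u0(2) by (rule flow_eq_solution[OF cont u0X, of "b i"]) (use zero_le_one in blast)
    have "\<bar>noise ?\<omega> x\<bar> \<le> C + \<eta> * (\<tau> + 1)" if "x \<in> {0..1}" for x
    proof -
      have "\<bar>noise ?\<omega> x\<bar> \<le> C + \<eta> * \<bar>x - \<tau> - 1\<bar>"
        using C(2)[of "x - \<tau> - 1"] that \<tau> by (simp add: shift_shift algebra_simps)
      also have "\<dots> \<le> C + \<eta> * (\<tau> + 1)"
        using that \<tau> \<eta>(1) by (intro add_left_mono mult_left_mono) auto
      finally show ?thesis .
    qed
    then have "sqnorm_X m u \<le> absorbing_const * exp (4 * M' * (C + \<eta> * (\<tau> + 1)))"
      unfolding U(2) using M' C(1) \<eta>(1) \<tau>
      by (intro absorbed_in_unit_time[OF U(1)]) auto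
    also have "4 * M' * (C + \<eta> * (\<tau> + 1)) = 4 * M' * C + \<rho> + \<rho> * \<tau>"
      by (simp add: algebra_simps flip: \<eta>(2))
    finally show "sqnorm_X m u \<le> absorbing_const * exp (4 * M' * C + \<rho>) * exp (\<rho> * \<tau>)"
      by (simp add: exp_add mult.assoc)
  qed (simp add: absorbing_const_nonneg)
qed

text \<open>For measurability: the distance to the closure of a countable union is the infimum of countably many
  measurable distances.\<close>

lemma closed_union_of_attractors_tempered:
  fixes b :: "nat \<Rightarrow> real"
  assumes adm: "admissible_paths P \<Omega>" and att: "\<And>i. random_attractor m P \<Omega> (flow (b i)) (A i)"
    and b: "\<And>i. \<bar>b i\<bar> \<le> M"
  shows "(\<lambda>\<omega>. top_X m closure_of (\<Union>i. A i \<omega>)) \<in> tempered_universe m P \<Omega>" (is "?D \<in> _")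
proof -
  have sub: "(\<Union>i. A i \<omega>) \<subseteq> X m" if "\<omega> \<in> \<Omega>" for \<omega>
    using random_attractor_subset_X[OF att that] by blast
  have closed: "closed_random_set m P \<Omega> (A i)" for i
    using att[of i] by (simp add: random_attractor_def tempered_universe_def)
  have "closed_random_set m P \<Omega> ?D"
    unfolding closed_random_set_def
  proof (intro conjI ballI)
    fix \<omega> assume \<omega>: "\<omega> \<in> \<Omega>"
    have "A 0 \<omega> \<noteq> {}" using closed[of 0] \<omega> by (simp add: closed_random_set_def)
    then show "?D \<omega> \<noteq> {}" using subset_closure_of_X[OF sub[OF \<omega>]] by blast
    show "closedin (top_X m) (?D \<omega>)" by simp
  next
    fix x assume x: "x \<in> X m"
    have "(\<lambda>\<omega>. INF i. point_dist_X m x (A i \<omega>)) \<in> borel_measurable (restrict_space P \<Omega>)"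
      using closed x by (intro borel_measurable_INF) (auto simp: closed_random_set_def)
    moreover have "point_dist_X m x (?D \<omega>) = (INF i. point_dist_X m x (A i \<omega>))"
      if "\<omega> \<in> space (restrict_space P \<Omega>)" for \<omega>
    proof -
      have "\<omega> \<in> \<Omega>" using that by (simp add: space_restrict_space)
      then show ?thesis
        using point_dist_X_closure[OF sub x] point_dist_X_UN by simp
    qed
    ultimately show "(\<lambda>\<omega>. point_dist_X m x (?D \<omega>)) \<in> borel_measurable (restrict_space P \<Omega>)"
      by (simp cong: measurable_cong)
  qed
  moreover have "((\<lambda>t. ennreal (exp (- \<rho> * t)) * (SUP \<phi>\<in>?D (shift (- t) \<omega>). ennreal (norm_X m \<phi>))) \<longlongrightarrow> 0) at_top"
    if \<rho>: "\<rho> > 0" and \<omega>: "\<omega> \<in> \<Omega>" for \<rho> \<omega>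
  proof -
    obtain C where C: "C \<ge> 0"
      "\<And>i \<tau> u. \<tau> \<ge> 0 \<Longrightarrow> u \<in> A i (shift (- \<tau>) \<omega>) \<Longrightarrow> sqnorm_X m u \<le> C * exp (\<rho> * \<tau>)"
      using attractors_uniformly_tempered[OF adm \<omega> att b \<rho>] by metis
    have bound: "ennreal (exp (- \<rho> * t)) * (SUP \<phi>\<in>?D (shift (- t) \<omega>). ennreal (norm_X m \<phi>))
        \<le> ennreal (sqrt C * exp (- (\<rho> / 2) * t))" if t: "t \<ge> 0" for t
    proof -
      have "norm_X m \<phi> \<le> sqrt C * exp (\<rho> / 2 * t)" if "\<phi> \<in> ?D (shift (- t) \<omega>)" for \<phi>
      proof (rule norm_X_closure_le[OF _ _ that])
        show "(\<Union>i. A i (shift (- t) \<omega>)) \<subseteq> X m" by (rule sub[OF admissible_shift[OF adm \<omega>]])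
        fix u assume "u \<in> (\<Union>i. A i (shift (- t) \<omega>))"
        then have "sqnorm_X m u \<le> C * exp (\<rho> * t)" using C(2)[OF t] by blast
        also have "exp (\<rho> * t) = (exp (\<rho> / 2 * t))\<^sup>2" by (simp add: power2_eq_square flip: exp_add)
        finally have "sqrt (sqnorm_X m u) \<le> sqrt (C * (exp (\<rho> / 2 * t))\<^sup>2)" by (rule real_sqrt_le_mono)
        then show "norm_X m u \<le> sqrt C * exp (\<rho> / 2 * t)" by (simp add: norm_X_eq_sqrt real_sqrt_mult)
      qed
      then have "(SUP \<phi>\<in>?D (shift (- t) \<omega>). ennreal (norm_X m \<phi>)) \<le> ennreal (sqrt C * exp (\<rho> / 2 * t))"
        by (intro SUP_least ennreal_leI) auto
      then have "ennreal (exp (- \<rho> * t)) * (SUP \<phi>\<in>?D (shift (- t) \<omega>). ennreal (norm_X m \<phi>))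
          \<le> ennreal (exp (- \<rho> * t)) * ennreal (sqrt C * exp (\<rho> / 2 * t))"
        by (rule mult_left_mono) simp
      also have "\<dots> = ennreal (exp (- \<rho> * t) * (sqrt C * exp (\<rho> / 2 * t)))"
        using C(1) by (intro ennreal_mult[symmetric]) auto
      also have "exp (- \<rho> * t) * (sqrt C * exp (\<rho> / 2 * t)) = sqrt C * (exp (- \<rho> * t) * exp (\<rho> / 2 * t))"
        by (simp only: mult_ac)
      also have "exp (- \<rho> * t) * exp (\<rho> / 2 * t) = exp (- (\<rho> / 2) * t)"
        by (simp add: field_simps flip: exp_add)
      finally show ?thesis .
    qed
    have "((\<lambda>t. sqrt C * exp (- (\<rho> / 2) * t)) \<longlongrightarrow> sqrt C * 0) at_top"
    proof (intro tendsto_intros filterlim_compose[OF exp_at_bot])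
      show "LIM t at_top. - (\<rho> / 2) * t :> at_bot"
        using \<rho> by (intro filterlim_tendsto_neg_mult_at_bot[OF tendsto_const _ filterlim_ident]) auto
    qed
    then have "((\<lambda>t. ennreal (sqrt C * exp (- (\<rho> / 2) * t))) \<longlongrightarrow> 0) at_top"
      using tendsto_ennrealI by fastforce
    then show ?thesis
      by (rule tendsto_sandwich[OF _ _ tendsto_const, rotated 2])
         (use bound in \<open>auto simp: eventually_at_top_linorder\<close>)
  qed
  ultimately show ?thesis by (simp add: tempered_universe_def)
qed

section \<open>Upper semicontinuity\<close>

text \<open>The attractor with parameter \<open>a0\<close> attracts the closed union \<open>D\<close> of all the others, which allows a time
  \<open>T\<close> to be fixed before \<open>n\<close>; on \<open>[0, T]\<close> the two flows are then close on \<open>D\<close> for large \<open>n\<close>.\<close>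

theorem attractors_upper_semicontinuous:
  fixes a :: "nat \<Rightarrow> real"
  assumes adm: "admissible_paths P \<Omega>" and \<omega>: "\<omega> \<in> \<Omega>"
    and att: "\<And>n. random_attractor m P \<Omega> (flow (a n)) (B n)"
    and att0: "random_attractor m P \<Omega> (flow a0) B0"
    and lim: "a \<longlonglongrightarrow> a0"
  shows "(\<lambda>n. dist_X m (B n \<omega>) (B0 \<omega>)) \<longlonglongrightarrow> 0"
proof -
  have "Bseq a" using lim by (intro convergent_imp_Bseq convergentI)
  then obtain M0 where M0: "\<forall>n. \<bar>a n\<bar> \<le> M0"
    unfolding Bseq_def by auto
  define M where "M = max M0 \<bar>a0\<bar>"
  have M: "M \<ge> 0" "\<And>n. \<bar>a n\<bar> \<le> M" "\<bar>a0\<bar> \<le> M"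
  proof -
    show le: "\<bar>a n\<bar> \<le> M" for n using M0[rule_format, of n] by (simp add: M_def)
    show "\<bar>a0\<bar> \<le> M" by (simp add: M_def)
    then show "M \<ge> 0" by linarith
  qed
  define D where "D = (\<lambda>\<omega>. top_X m closure_of (\<Union>n. B n \<omega>))"
  have D: "D \<in> tempered_universe m P \<Omega>"
    unfolding D_def by (rule closed_union_of_attractors_tempered[where A = B and b = a, OF adm att M(2)])
  have attr: "((\<lambda>t. dist_X m (flow a0 t (shift (- t) \<omega>) ` D (shift (- t) \<omega>)) (B0 \<omega>)) \<longlongrightarrow> 0) at_top"
    using att0 D \<omega> unfolding random_attractor_def by blast
  have small: "\<forall>\<^sub>F n in sequentially. dist_X m (B n \<omega>) (B0 \<omega>) \<le> ennreal (2 * \<epsilon>)" if \<epsilon>: "\<epsilon> > 0" for \<epsilon> :: real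
  proof -
    have ev: "\<forall>\<^sub>F t in at_top. dist_X m (flow a0 t (shift (- t) \<omega>) ` D (shift (- t) \<omega>)) (B0 \<omega>) < ennreal \<epsilon> \<and> 0 \<le> t"
      by (intro eventually_conj order_tendstoD(2)[OF attr] eventually_ge_at_top) (use \<epsilon> in simp)
    \<comment> \<open>The pullback time is fixed here, before \<open>n\<close>.\<close>
    obtain T where T: "T \<ge> 0" "dist_X m (flow a0 T (shift (- T) \<omega>) ` D (shift (- T) \<omega>)) (B0 \<omega>) < ennreal \<epsilon>"
      using eventually_happens'[OF trivial_limit_at_top_linorder ev] by blast
    define \<omega>' where "\<omega>' = shift (- T) \<omega>"
    have \<omega>': "\<omega>' \<in> \<Omega>" unfolding \<omega>'_def by (rule admissible_shift[OF adm \<omega>])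
    have return: "shift T \<omega>' = \<omega>" using admissible_shift_0[OF adm \<omega>] by (simp add: \<omega>'_def shift_shift)
    have cont: "continuous_on UNIV (noise \<omega>')" using adm \<omega>' by (simp add: admissible_paths_def)
    have cont0: "continuous_on {0..} (noise \<omega>')" using cont by (rule continuous_on_subset) simp
    obtain C where "C \<ge> 0" and C0: "\<And>n \<tau> u. \<tau> \<ge> 0 \<Longrightarrow> u \<in> B n (shift (- \<tau>) \<omega>) \<Longrightarrow> sqnorm_X m u \<le> C * exp (1 * \<tau>)"
      by (rule attractors_uniformly_tempered[where A = B and b = a and \<rho> = 1, OF adm \<omega> att M(2) zero_less_one])
        (rule that)
    have C: "sqnorm_X m u \<le> C * exp (1 * T)" if "u \<in> B n \<omega>'" for n u
      by (rule C0[OF T(1) that[unfolded \<omega>'_def]])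
    obtain K where K: "\<And>b b' u0 U V t. \<bar>b\<bar> \<le> M \<Longrightarrow> \<bar>b'\<bar> \<le> M \<Longrightarrow> sqnorm_X m u0 \<le> C * exp (1 * T) \<Longrightarrow>
        solves m (field full b (noise \<omega>')) u0 U \<Longrightarrow> solves m (field full b' (noise \<omega>')) u0 V \<Longrightarrow> t \<in> {0..T} \<Longrightarrow>
        sqnorm_X m (\<lambda>j. U t j - V t j) \<le> K * (b - b')\<^sup>2"
      by (rule solution_stability[where r = "C * exp (1 * T)" and T = T, OF cont0 M(1)])
        (rule that)
    have "(\<lambda>n. K * (a n - a0)\<^sup>2) \<longlonglongrightarrow> K * (a0 - a0)\<^sup>2"
      by (intro tendsto_intros lim)
    then have "\<forall>\<^sub>F n in sequentially. K * (a n - a0)\<^sup>2 < \<epsilon>\<^sup>2"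
      by (rule order_tendstoD(2)) (use \<epsilon> in simp)
    then show ?thesis
    proof eventually_elim
      case (elim n)
      show ?case unfolding dist_X_def
      proof (rule SUP_least)
        fix x assume "x \<in> B n \<omega>"
        moreover have "flow (a n) T \<omega>' ` B n \<omega>' = B n \<omega>"
          using att[of n] \<omega>' T(1) return by (simp add: random_attractor_def)
        ultimately obtain u where u: "u \<in> B n \<omega>'" "x = flow (a n) T \<omega>' u" by blast
        \<comment> \<open>Compare \<open>x\<close> with the point \<open>z\<close> reached from the same initial value with parameter \<open>a0\<close>.\<close>
        have BX: "(\<Union>n. B n \<omega>') \<subseteq> X m"
          using random_attractor_subset_X[OF att \<omega>'] by blast
        then have uX: "u \<in> X m" using u(1) by blast
        define z where "z = flow a0 T \<omega>' u"
        obtain U where U: "solves m (field full (a n) (noise \<omega>')) u U" "x = U T"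
          unfolding u(2) by (rule flow_eq_solution[OF cont uX, of "a n"]) (use T(1) in blast)
        obtain V where V: "solves m (field full a0 (noise \<omega>')) u V" "z = V T"
          unfolding z_def by (rule flow_eq_solution[OF cont uX, of a0]) (use T(1) in blast)
        have "sqnorm_X m (\<lambda>j. x j - z j) \<le> \<epsilon>\<^sup>2"
          using K[OF M(2)[of n] M(3) C[OF u(1)] U(1) V(1), of T] T(1) elim by (simp add: U(2) V(2))
        then have dxz: "d_X m x z \<le> \<epsilon>"
          using \<epsilon> by (simp add: d_X_eq_sqrt real_le_lsqrt)
        have "u \<in> D \<omega>'" using subset_closure_of_X[OF BX] u(1) by (auto simp: D_def)
        then have "point_dist_X m z (B0 \<omega>) \<le> dist_X m (flow a0 T \<omega>' ` D \<omega>') (B0 \<omega>)"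
          unfolding dist_X_def z_def by (intro SUP_upper) auto
        also have "\<dots> \<le> ennreal \<epsilon>" using T(2) by (simp add: \<omega>'_def)
        finally have zB: "point_dist_X m z (B0 \<omega>) \<le> ennreal \<epsilon>" .
        have "x \<in> X m" "z \<in> X m" using U V T(1) by (auto simp: solves_def)
        then have "point_dist_X m x (B0 \<omega>) \<le> ennreal (d_X m x z) + point_dist_X m z (B0 \<omega>)"
          by (rule point_dist_X_triangle[OF _ _ random_attractor_subset_X[OF att0 \<omega>]])
        also have "\<dots> \<le> ennreal \<epsilon> + ennreal \<epsilon>"
          using dxz zB by (intro add_mono ennreal_leI)
        also have "\<dots> = ennreal (2 * \<epsilon>)" using \<epsilon> by (simp flip: ennreal_plus)
        finally show "point_dist_X m x (B0 \<omega>) \<le> ennreal (2 * \<epsilon>)" .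
      qed
    qed
  qed
  show ?thesis
  proof (rule order_tendstoI)
    fix e :: ennreal assume "0 < e"
    then obtain x where x: "0 < x" "x < e" using dense by blast
    define r where "r = enn2real x"
    have "x < top" using x(2) top_greatest by (rule less_le_trans)
    then have r: "0 < r" "ennreal r < e" using x by (simp_all add: r_def enn2real_positive_iff)
    show "\<forall>\<^sub>F n in sequentially. dist_X m (B n \<omega>) (B0 \<omega>) < e"
      using small[of "r / 2"] r by (auto elim!: eventually_mono intro: le_less_trans)
  qed simp
qed

end

theorem theorem5p5:
  fixes lam \<gamma> k p \<mu> \<beta> \<nu> :: real
    and g :: "int \<Rightarrow> complex"
    and m :: nat
    and P :: "(real \<Rightarrow> real) measure"
    and \<Omega> :: "(real \<Rightarrow> real) set"
    and A :: "real \<Rightarrow> (real \<Rightarrow> real) \<Rightarrow> (int \<Rightarrow> complex) set"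
    and a0 :: real
    and a :: "nat \<Rightarrow> real"
    and \<omega> :: "real \<Rightarrow> real"
  assumes "lam > 0" "\<gamma> > 0" "k > 0" "p > 0" "\<gamma> > 4 * lam"
    and "(\<lambda>j. cmod (g j) powr ((p + 2) / (p + 1))) summable_on UNIV"
    and "two_sided_Wiener P"
    and "admissible_paths P \<Omega>"
    and "\<And>b. b > 0 \<Longrightarrow> random_attractor m P \<Omega> (Xi lam \<mu> \<gamma> \<beta> k \<nu> p g m b) (A b)"
    and "a0 > 0" "\<And>n. a n > 0" "a \<longlonglongrightarrow> a0"
    and "\<omega> \<in> \<Omega>"
  shows "(\<lambda>n. dist_X m (A (a n) \<omega>) (A a0 \<omega>)) \<longlonglongrightarrow> 0"
proof -
  interpret truncated_lattice lam \<gamma> k p \<mu> \<beta> \<nu> g m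
    using assms(1,3,4,5) by unfold_locales
  show ?thesis
    using assms(9)[OF assms(11)] assms(9)[OF assms(10)]
    by (rule attractors_upper_semicontinuous[OF assms(8,13) _ _ assms(12)])
qed

end
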